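(* Let $P$ be a probability measure on $(\Omega,\mathcal F)$ under which the coordinate process $X$ is a nonnegative local martingale with $P(X_0=1)=1$. Set $b:=P(T_0=\mathfrak T)=P(X_\infty>0)$. Let $Q$ be the Föllmer measure of $X$, let $\widetilde Q$ (defined when $b=0$) be the upward conditioned measure, and let $\widehat Q=P(\cdot|T_0=\mathfrak T)$ (defined when $b>0$). Then: (i) If $b=0$, then $Q=\widetilde Q$. (ii) If $b>0$, then $Q=\widehat Q$ if and only if $X$ is a uniformly integrable $P$-martingale with $P(X_\infty\in\{0,1/b\})=1$.
   Context: $\Omega=C_{\mathrm{abs}}$ is the space of functions $\omega:[0,\infty)\to[0,\infty]$ that are absorbed in $0$ and in $\infty$ (once $\omega$ reaches $0$ or $\infty$ it stays there) and that are continuous on $[0,T_\infty(\omega))$, where $T_\infty(\omega)$ is the first hitting time of $\{\infty\}$. $X$ is the coordinate process, $X_t(\omega)=\omega(t)$, and $X_\infty:=\sqrt{\limsup_{t\uparrow\infty}X_t\,\liminf_{t\uparrow\infty}X_t}$ with the convention $\infty\cdot 0:=1$. The filtration is $\mathcal F_t=\sigma(X_s:s\le t)$ and $\mathcal F=\bigvee_{t\ge0}\mathcal F_t$; martingales and local martingales are with respect to this filtration. For $a\in[0,\infty]$, $T_a=\inf\{t\in[0,\infty]:X_t=a\}$ (the time $t=\infty$ is allowed), with $\inf\emptyset:=\mathfrak T$, where $\mathfrak T$ is an extra symbol ("time beyond infinity") and the order is extended to $[0,\infty]\cup\{\mathfrak T\}$ by $t<\mathfrak T$ for all $t\in[0,\infty]$.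 For a stopping time $\tau$, $X^\tau$ is $X$ stopped at $\tau$, $X_\tau$ denotes $X^\tau_\infty$, and $\mathcal F_\tau=\{A\in\mathcal F:A\cap\{\tau\le t\}\in\mathcal F_t\ \forall t\in[0,\infty)\}=\sigma(X^\tau_s:s<\infty)$. Föllmer measure: $Q$ is the unique probability measure on $(\Omega,\mathcal F)$ satisfying $\mathrm dQ|_{\mathcal F_\tau}=X_\tau\,\mathrm dP|_{\mathcal F_\tau}$ for all stopping times $\tau$ for which $X^\tau$ is a uniformly integrable $P$-martingale (its existence is known). Upward conditioned measure: if $P(T_0=\mathfrak T)=0$, the family $\{P(\cdot|T_a\le T_0)\}_{a>1}$ is consistent on the filtration $(\mathcal F_{T_a})_{a>1}$, and $\widetilde Q$ is the unique probability measure on $(\Omega,\mathcal F)$ with $\widetilde Q|_{\mathcal F_{T_a}}=P(\cdot|T_a\le T_0)|_{\mathcal F_{T_a}}$ for all $a>1$. If $P(T_0=\mathfrak T)>0$, $\widehat Q(\cdot)=P(\cdot|T_0=\mathfrak T)$ is the measure with density $\mathbf 1_{\{T_0=\mathfrak T\}}/P(T_0=\mathfrak T)$ with respect to $P$. *)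

theory Defs
  imports "HOL-Probability.Probability"
begin

text \<open>The time set \<open>[0,\<infinity>] \<union> {\<TT>}\<close>; \<open>Beyond\<close> is the symbol \<open>\<TT>\<close>
  (``time beyond infinity''), the largest element.\<close>

datatype etime = Time ennreal | Beyond

instantiation etime :: linorder
begin

definition less_eq_etime :: "etime \<Rightarrow> etime \<Rightarrow> bool" where
  "u \<le> v \<longleftrightarrow> (case v of Beyond \<Rightarrow> True
    | Time t \<Rightarrow> (case u of Beyond \<Rightarrow> False | Time s \<Rightarrow> s \<le> t))"

definition less_etime :: "etime \<Rightarrow> etime \<Rightarrow> bool" where
  "u < v \<longleftrightarrow> u \<le> v \<and> \<not> v \<le> (u::etime)"

instance
  by standard (auto simp: less_eq_etime_def less_etime_def split: etime.splits)

end

text \<open>A path \<open>[0,\<infinity>) \<rightarrow> [0,\<infinity>]\<close> is a function on the reals that is \<^const>\<open>undefined\<close>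
  outside \<open>{0..}\<close>; see \<open>C_abs\<close> below.\<close>

type_synonym path = "real \<Rightarrow> ennreal"

definition ennreal_sqrt :: "ennreal \<Rightarrow> ennreal" where
  "ennreal_sqrt x = (if x = \<infinity> then \<infinity> else ennreal (sqrt (enn2real x)))"

text \<open>The first case is the convention \<open>\<infinity> \<cdot> 0 := 1\<close>; in \<^typ>\<open>ennreal\<close> this product is \<open>0\<close>.\<close>

definition coord_infinity :: "path \<Rightarrow> ennreal" where
  "coord_infinity \<omega> =
     (if Limsup at_top \<omega> = \<infinity> \<and> Liminf at_top \<omega> = 0 then 1
      else ennreal_sqrt (Limsup at_top \<omega> * Liminf at_top \<omega>))"

definition coord :: "ennreal \<Rightarrow> path \<Rightarrow> ennreal" where
  "coord t \<omega> = (if t = \<infinity> then coord_infinity \<omega> else \<omega> (enn2real t))"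

definition hit :: "ennreal \<Rightarrow> path \<Rightarrow> etime" where
  "hit a \<omega> = (if \<exists>t. coord t \<omega> = a then Time (Inf {t. coord t \<omega> = a}) else Beyond)"

text \<open>The last condition says that a finite hitting time of \<open>\<infinity>\<close> is attained. Continuity on
  \<open>[0, T\<^sub>\<infinity>)\<close> alone leaves the value at \<open>T\<^sub>\<infinity>\<close> free: a path could be arbitrary at time \<open>1\<close> and
  infinite only on \<open>(1,\<infinity>)\<close>, and then the hitting times would not be stopping times.\<close>

definition C_abs :: "path set" where
  "C_abs = {\<omega> \<in> extensional {0..}.
     (\<forall>s t. 0 \<le> s \<longrightarrow> s \<le> t \<longrightarrow> \<omega> s \<in> {0, \<infinity>} \<longrightarrow> \<omega> t = \<omega> s) \<and>
     continuous_on {t. 0 \<le> t \<and> Time (ennreal t) < hit \<infinity> \<omega>} \<omega> \<and>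
     (\<forall>t\<ge>0. hit \<infinity> \<omega> = Time (ennreal t) \<longrightarrow> \<omega> t = \<infinity>)}"

text \<open>\<open>filt (Time t)\<close> is \<open>\<F>\<^sub>t\<close> for \<open>t < \<infinity>\<close>, while \<open>filt (Time \<infinity>) = filt Beyond = \<F>\<close>.
  With this index set, \<^const>\<open>stopping_time\<close> also asks that \<open>{\<tau> \<le> \<infinity>} \<in> \<F>\<close>.\<close>

definition filt :: "etime \<Rightarrow> path measure" where
  "filt u = sigma C_abs
     {{\<omega> \<in> C_abs. coord s \<omega> \<in> B} | s B. s < \<infinity> \<and> Time s \<le> u \<and> B \<in> sets borel}"

definition filt_at :: "(path \<Rightarrow> etime) \<Rightarrow> path measure" where
  "filt_at \<tau> = sigma C_abs
     {A \<in> sets (filt Beyond). \<forall>t<\<infinity>. A \<inter> {\<omega>. \<tau> \<omega> \<le> Time t} \<in> sets (filt (Time t))}"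

text \<open>\<open>stopped \<tau> t\<close> is \<open>X\<close> at time \<open>\<tau> \<and> t\<close>; in particular \<open>stopped \<tau> \<infinity>\<close> is \<open>X\<^sub>\<tau>\<close>, which is
  \<open>X\<^sub>\<infinity>\<close> where \<open>\<tau> \<in> {\<infinity>, \<TT>}\<close>.\<close>

definition stopped :: "(path \<Rightarrow> etime) \<Rightarrow> ennreal \<Rightarrow> path \<Rightarrow> ennreal" where
  "stopped \<tau> t \<omega> = (case \<tau> \<omega> of Time s \<Rightarrow> coord (min s t) \<omega> | Beyond \<Rightarrow> coord t \<omega>)"

text \<open>Martingales and uniform integrability for \<open>[0,\<infinity>]\<close>-valued processes indexed by \<open>[0,\<infinity>)\<close>.\<close>

definition nonneg_martingale :: "path measure \<Rightarrow> (ennreal \<Rightarrow> path \<Rightarrow> ennreal) \<Rightarrow> bool" where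
  "nonneg_martingale P Y \<longleftrightarrow>
     (\<forall>t<\<infinity>. Y t \<in> borel_measurable (filt (Time t)) \<and> (\<integral>\<^sup>+\<omega>. Y t \<omega> \<partial>P) < \<infinity>) \<and>
     (\<forall>s t. s \<le> t \<longrightarrow> t < \<infinity> \<longrightarrow> (AE \<omega> in P. nn_cond_exp P (filt (Time s)) (Y t) \<omega> = Y s \<omega>))"

definition uniformly_integrable :: "path measure \<Rightarrow> (ennreal \<Rightarrow> path \<Rightarrow> ennreal) \<Rightarrow> bool" where
  "uniformly_integrable P Y \<longleftrightarrow>
     ((\<lambda>K::real. SUP t\<in>{..<\<infinity>}. (\<integral>\<^sup>+\<omega>\<in>{\<omega>. ennreal K \<le> Y t \<omega>}. Y t \<omega> \<partial>P)) \<longlongrightarrow> 0) at_top"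

definition ui_martingale :: "path measure \<Rightarrow> (ennreal \<Rightarrow> path \<Rightarrow> ennreal) \<Rightarrow> bool" where
  "ui_martingale P Y \<longleftrightarrow> nonneg_martingale P Y \<and> uniformly_integrable P Y"

definition coord_local_martingale :: "path measure \<Rightarrow> bool" where
  "coord_local_martingale P \<longleftrightarrow>
     (\<exists>\<tau> :: nat \<Rightarrow> path \<Rightarrow> etime.
        (\<forall>n. stopping_time filt (\<tau> n) \<and> nonneg_martingale P (stopped (\<tau> n))) \<and>
        (AE \<omega> in P. incseq (\<lambda>n. \<tau> n \<omega>) \<and> (\<forall>t<\<infinity>. \<exists>n. Time t < \<tau> n \<omega>)))"

definition is_foellmer_measure :: "path measure \<Rightarrow> path measure \<Rightarrow> bool" where
  "is_foellmer_measure P Q \<longleftrightarrow>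
     prob_space Q \<and> sets Q = sets (filt Beyond) \<and>
     (\<forall>\<tau>. stopping_time filt \<tau> \<longrightarrow> ui_martingale P (stopped \<tau>) \<longrightarrow>
        (\<forall>A\<in>sets (filt_at \<tau>). emeasure Q A = (\<integral>\<^sup>+\<omega>\<in>A. stopped \<tau> \<infinity> \<omega> \<partial>P)))"

definition is_upward_conditioned_measure :: "path measure \<Rightarrow> path measure \<Rightarrow> bool" where
  "is_upward_conditioned_measure P Q \<longleftrightarrow>
     prob_space Q \<and> sets Q = sets (filt Beyond) \<and>
     (\<forall>a::real. a > 1 \<longrightarrow>
        (\<forall>A\<in>sets (filt_at (hit (ennreal a))).
           emeasure Q A = emeasure (uniform_measure P {\<omega>\<in>C_abs. hit (ennreal a) \<omega> \<le> hit 0 \<omega>}) A))"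

end

theory Submission
  imports Defs
begin

text \<open>Write \<open>T\<^sub>a\<close> for the hitting time of the level \<open>a\<close>, where \<open>a \<ge> 1\<close> is finite. Under \<open>P\<close> the
  process starts in \<open>1\<close>, almost surely never becomes infinite in finite time and is therefore
  continuous, so that \<open>X\<close> stopped at \<open>T\<^sub>a\<close> is bounded by \<open>a\<close>. A bounded local martingale is a
  uniformly integrable martingale (\<open>ui_martingale_stopped_hit\<close>, which rests on \<open>optional_stopping\<close>).
  Hence the defining property of the Foellmer measure applies to \<open>T\<^sub>a\<close>: on the events known at
  \<open>T\<^sub>a\<close> the measure \<open>Q\<close> has the density \<open>X\<close> at \<open>T\<^sub>a\<close> with respect to \<open>P\<close>. Moreover
  \<open>T\<^sub>0 = \<TT>\<close> holds exactly where \<open>X\<^sub>\<infinity> > 0\<close>, because absorption in \<open>0\<close> forces \<open>X\<^sub>\<infinity> = 0\<close>.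

  Suppose \<open>b = 0\<close>. Then \<open>X\<^sub>\<infinity> = 0\<close> almost surely, so \<open>X\<close> at \<open>T\<^sub>a\<close> is \<open>a\<close> where \<open>a\<close> is hit and \<open>0\<close>
  elsewhere. A density that is constant on an event and zero outside of it is conditioning on that
  event, which up to a null set is the event \<open>T\<^sub>a \<le> T\<^sub>0\<close> (\<open>foellmer_measure_hit_conditioned\<close>). So
  \<open>Q\<close> is an upward conditioned measure. There is only one, because the coordinates of a path are
  limits of the coordinates of the path stopped at \<open>T\<^sub>n\<close>, even if the path explodes, and these are
  known at \<open>T\<^sub>n\<close> (\<open>measure_eqI_before_hits\<close>).

  Suppose \<open>b > 0\<close>. If \<open>X\<close> is a uniformly integrable martingale then \<open>Q\<close> has density \<open>X\<^sub>\<infinity>\<close>, while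
  the conditional measure has density \<open>1 / b\<close> on \<open>X\<^sub>\<infinity> > 0\<close>; the two measures agree if and only if
  \<open>X\<^sub>\<infinity>\<close> almost surely takes only the values \<open>0\<close> and \<open>1 / b\<close> (\<open>foellmer_eq_conditioned_iff\<close>).
  Conversely, if \<open>Q\<close> is the conditional measure then its density is at most \<open>1 / b\<close>, which bounds
  \<open>X\<close> at \<open>T\<^sub>a\<close>; so levels \<open>a > 1 / b\<close> are almost surely never hit, and \<open>X\<close> itself is bounded and a
  uniformly integrable martingale (\<open>ui_martingale_if_foellmer_conditioned\<close>).\<close>

section \<open>Paths and hitting times\<close>

lemma Time_le_Time [simp]: "Time s \<le> Time t \<longleftrightarrow> s \<le> t"
  by (simp add: less_eq_etime_def)

lemma le_Beyond [simp]: "u \<le> Beyond"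
  by (simp add: less_eq_etime_def)

lemma Beyond_le_Time [simp]: "\<not> Beyond \<le> Time t"
  by (simp add: less_eq_etime_def)

lemma Time_less_Time [simp]: "Time s < Time t \<longleftrightarrow> s < t"
  by (auto simp: less_etime_def)

lemma Time_less_Beyond [simp]: "Time s < Beyond"
  by (simp add: less_etime_def)

lemma coord_ennreal [simp]: "0 \<le> r \<Longrightarrow> coord (ennreal r) \<omega> = \<omega> r"
  by (simp add: coord_def)

lemma coord_top [simp]: "coord \<infinity> \<omega> = coord_infinity \<omega>" "coord top \<omega> = coord_infinity \<omega>"
  by (simp_all add: coord_def)

lemma stopped_coord:
  "stopped \<tau> t \<omega> = coord (case \<tau> \<omega> of Time s \<Rightarrow> min s t | Beyond \<Rightarrow> t) \<omega>"
  by (simp add: stopped_def split: etime.splits)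

lemma hit_eq_Beyond_iff: "hit a \<omega> = Beyond \<longleftrightarrow> (\<forall>t. coord t \<omega> \<noteq> a)"
  by (auto simp: hit_def)

lemma hit_le: "coord t \<omega> = a \<Longrightarrow> hit a \<omega> \<le> Time t"
  by (auto simp: hit_def intro!: Inf_lower)

lemma ennreal_times:
  obtains "t = \<infinity>" | r where "0 \<le> r" "t = ennreal r"
  by (cases t) auto

lemma path_absorbed:
  assumes "\<omega> \<in> C_abs" "0 \<le> s" "s \<le> t" "\<omega> s = 0 \<or> \<omega> s = \<infinity>"
  shows "\<omega> t = \<omega> s"
  using assms unfolding C_abs_def by blast

lemma path_finite_before:
  assumes "\<omega> \<in> C_abs" "0 \<le> s" "s \<le> t" "\<omega> t \<noteq> \<infinity>"
  shows "\<omega> s \<noteq> \<infinity>"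
  using path_absorbed[OF assms(1-3)] assms(4) by auto

lemma less_hit_infinity_iff:
  assumes "\<omega> \<in> C_abs" "0 \<le> t"
  shows "Time (ennreal t) < hit \<infinity> \<omega> \<longleftrightarrow> \<omega> t \<noteq> \<infinity>"
proof
  assume "Time (ennreal t) < hit \<infinity> \<omega>"
  then show "\<omega> t \<noteq> \<infinity>"
    using hit_le[of "ennreal t" \<omega> \<infinity>] assms(2) by (auto simp: less_etime_def)
next
  assume fin: "\<omega> t \<noteq> \<infinity>"
  show "Time (ennreal t) < hit \<infinity> \<omega>"
  proof (rule ccontr)
    assume "\<not> ?thesis"
    then have le: "hit \<infinity> \<omega> \<le> Time (ennreal t)" by simp
    then obtain s where s: "hit \<infinity> \<omega> = Time s" "s \<le> ennreal t"
      by (cases "hit \<infinity> \<omega>") auto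
    then obtain r where r: "0 \<le> r" "s = ennreal r"
      by (cases s) (auto simp: top_unique)
    have "\<omega> r = \<infinity>" using assms(1) s(1) r unfolding C_abs_def by blast
    moreover have "r \<le> t" using s(2) r assms(2) by simp
    ultimately show False using path_finite_before[OF assms(1) r(1)] fin by blast
  qed
qed

lemma path_finite_after:
  assumes "\<omega> \<in> C_abs" "0 \<le> t" "\<omega> t \<noteq> \<infinity>"
  shows "\<exists>r>t. \<omega> r \<noteq> \<infinity>"
proof -
  have *: "Time (ennreal t) < hit \<infinity> \<omega>" using assms less_hit_infinity_iff by blast
  obtain r where "t < r" "Time (ennreal r) < hit \<infinity> \<omega>"
  proof (cases "hit \<infinity> \<omega>")
    case (Time s)
    then have "ennreal t < s" using * by simp
    then obtain u where u: "ennreal t < u" "u < s" using dense by blast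
    then obtain r where "0 \<le> r" "u = ennreal r" by (cases u) auto
    then show ?thesis using that u Time assms(2) by (auto simp: ennreal_less_iff)
  next
    case Beyond then show ?thesis using that[of "t + 1"] by simp
  qed
  then show ?thesis using assms less_hit_infinity_iff[of \<omega> r] by auto
qed

lemma path_continuous_on:
  assumes "\<omega> \<in> C_abs" "0 \<le> r" "\<omega> r \<noteq> \<infinity>"
  shows "continuous_on {0..r} \<omega>"
proof (rule continuous_on_subset)
  show "continuous_on {t. 0 \<le> t \<and> Time (ennreal t) < hit \<infinity> \<omega>} \<omega>"
    using assms(1) unfolding C_abs_def by blast
  show "{0..r} \<subseteq> {t. 0 \<le> t \<and> Time (ennreal t) < hit \<infinity> \<omega>}"
    using assms less_hit_infinity_iff[OF assms(1)] path_finite_before[OF assms(1)]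
    by (metis (no_types, lifting) atLeastAtMost_iff mem_Collect_eq subsetI)
qed

text \<open>The only discontinuity of a path is a jump to \<open>\<infinity>\<close>, and the value at the jump is \<open>\<infinity>\<close>.\<close>

lemma path_right_continuous:
  assumes "\<omega> \<in> C_abs" "0 \<le> t"
  shows "(\<omega> \<longlongrightarrow> \<omega> t) (at_right t)"
proof (cases "\<omega> t = \<infinity>")
  case True
  have "eventually (\<lambda>u. \<omega> u = \<omega> t) (at_right t)"
    unfolding eventually_at_right_field
    using path_absorbed[OF assms] True by (intro exI[of _ "t + 1"]) auto
  then show ?thesis by (rule tendsto_eventually)
next
  case False
  then obtain r where r: "r > t" "\<omega> r \<noteq> \<infinity>" using path_finite_after assms by blast
  have "continuous_on {t..r} \<omega>"
    by (rule continuous_on_subset[OF path_continuous_on[OF assms(1) _ r(2)]]) (use r assms in auto)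
  then show ?thesis
    using r(1) continuous_on_Icc_at_rightD by blast
qed

text \<open>The infimum in the definition of a hitting time is attained by right-continuity; this makes
  \<open>X\<close> stopped at \<open>T\<^sub>a\<close> equal to \<open>a\<close> from \<open>T\<^sub>a\<close> on.\<close>

lemma hit_attained:
  assumes "\<omega> \<in> C_abs" "hit a \<omega> = Time s"
  shows "coord s \<omega> = a"
proof -
  define S where "S = {t. coord t \<omega> = a}"
  have S: "S \<noteq> {}" "s = Inf S"
    using assms(2) by (auto simp: hit_def S_def split: if_splits)
  have lower: "s \<le> t" if "t \<in> S" for t using S(2) that by (simp add: Inf_lower)
  show ?thesis
  proof (cases s rule: ennreal_times)
    case 1
    obtain t where "t \<in> S" using S by blast
    then have "t = \<infinity>" "t \<in> S" using lower[of t] 1 by (auto simp: top_unique)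
    then show ?thesis using 1 by (simp add: S_def)
  next
    case (2 r)
    show ?thesis
    proof (rule ccontr)
      assume "coord s \<omega> \<noteq> a"
      then have "\<omega> r \<noteq> a" using 2 by simp
      then have "eventually (\<lambda>u. \<omega> u \<noteq> a) (at_right r)"
        using path_right_continuous[OF assms(1) 2(1)] tendsto_imp_eventually_ne by blast
      then obtain d where d: "d > r" "\<And>u. r < u \<Longrightarrow> u < d \<Longrightarrow> \<omega> u \<noteq> a"
        by (auto simp: eventually_at_right_field)
      have "ennreal d \<le> t" if t: "t \<in> S" for t
      proof (cases t rule: ennreal_times)
        case (2 u)
        have "r \<le> u" using lower[OF t] \<open>s = ennreal r\<close> 2 \<open>0 \<le> r\<close> by simp
        moreover have "\<omega> u = a" using t 2 by (simp add: S_def)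
        ultimately have "d \<le> u" using d(2)[of u] \<open>\<omega> r \<noteq> a\<close> by (cases "r = u") force+
        then show ?thesis using 2 by (simp add: ennreal_leI)
      qed simp
      then have "ennreal d \<le> s" using S(2) by (simp add: Inf_greatest)
      then show False using 2 d(1) by (simp add: ennreal_le_iff)
    qed
  qed
qed

lemma hit_le_iff:
  assumes "\<omega> \<in> C_abs" "0 \<le> r"
  shows "hit a \<omega> \<le> Time (ennreal r) \<longleftrightarrow> (\<exists>u\<in>{0..r}. \<omega> u = a)"
proof
  assume le: "hit a \<omega> \<le> Time (ennreal r)"
  then obtain s where s: "hit a \<omega> = Time s" "s \<le> ennreal r"
    by (cases "hit a \<omega>") auto
  then obtain u where u: "0 \<le> u" "s = ennreal u" by (cases s) (auto simp: top_unique)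
  have "\<omega> u = a" using hit_attained[OF assms(1) s(1)] u by simp
  then show "\<exists>u\<in>{0..r}. \<omega> u = a" using u s(2) assms(2) by auto
next
  assume "\<exists>u\<in>{0..r}. \<omega> u = a"
  then obtain u where "0 \<le> u" "u \<le> r" "\<omega> u = a" by auto
  then have "hit a \<omega> \<le> Time (ennreal u)" "Time (ennreal u) \<le> Time (ennreal r)"
    using hit_le[of "ennreal u" \<omega> a] by (auto simp: ennreal_leI)
  then show "hit a \<omega> \<le> Time (ennreal r)" by (rule order_trans)
qed

lemma hit_le_infinity_iff:
  "hit a \<omega> \<le> Time \<infinity> \<longleftrightarrow> (\<exists>u\<ge>0. \<omega> u = a) \<or> coord_infinity \<omega> = a"
proof -
  have "hit a \<omega> \<le> Time \<infinity> \<longleftrightarrow> (\<exists>t. coord t \<omega> = a)" by (simp add: hit_def)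
  also have "\<dots> \<longleftrightarrow> (\<exists>u\<ge>0. \<omega> u = a) \<or> coord_infinity \<omega> = a"
    by (metis coord_ennreal coord_top(1) ennreal_times)
  finally show ?thesis .
qed

lemma stopped_hit:
  assumes "\<omega> \<in> C_abs"
  shows "stopped (hit a) t \<omega> = (if hit a \<omega> \<le> Time t then a else coord t \<omega>)"
  using hit_attained[OF assms] by (auto simp: stopped_def min_def split: etime.splits)

lemma coord_infinity_absorbed:
  assumes "\<omega> \<in> C_abs" "0 \<le> r" "\<omega> r = 0"
  shows "coord_infinity \<omega> = 0"
proof -
  have "eventually (\<lambda>u. \<omega> u = 0) at_top"
    unfolding eventually_at_top_linorder using path_absorbed[OF assms(1,2)] assms(3) by auto
  then have "Limsup at_top \<omega> = 0" "Liminf at_top \<omega> = 0"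
    using Limsup_eq[of \<omega> "\<lambda>_. 0" at_top] Liminf_eq[of \<omega> "\<lambda>_. 0" at_top]
    by (simp_all add: Limsup_const Liminf_const)
  then show ?thesis by (simp add: coord_infinity_def ennreal_sqrt_def)
qed

lemma hit_zero_eq_Beyond_iff:
  assumes "\<omega> \<in> C_abs"
  shows "hit 0 \<omega> = Beyond \<longleftrightarrow> coord_infinity \<omega> > 0"
  unfolding hit_eq_Beyond_iff
  by (metis assms coord_ennreal coord_infinity_absorbed coord_top(1) ennreal_times
      less_numeral_extra(3) zero_less_iff_neq_zero)

text \<open>A path that is absorbed in \<open>0\<close> cannot come back, so that a level is hit before \<open>0\<close> as soon
  as it is hit at all. The second alternative comes from \<open>Beyond \<le> Beyond\<close>.\<close>

lemma hit_le_hit_zero_iff: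
  assumes "\<omega> \<in> C_abs" "a \<noteq> 0"
  shows "hit a \<omega> \<le> hit 0 \<omega> \<longleftrightarrow> hit a \<omega> \<le> Time \<infinity> \<or> hit 0 \<omega> = Beyond"
proof (cases "hit a \<omega>")
  case (Time s)
  have "\<not> hit 0 \<omega> < Time s"
  proof
    assume "hit 0 \<omega> < Time s"
    then obtain r where r: "hit 0 \<omega> = Time r" "r < s" by (cases "hit 0 \<omega>") (auto simp: less_etime_def)
    then obtain r' where r': "r = ennreal r'" "0 \<le> r'" by (cases r) auto
    have "\<omega> r' = 0" using hit_attained[OF assms(1) r(1)] r' by simp
    moreover have "coord s \<omega> = 0"
    proof (cases s rule: ennreal_times)
      case 1 then show ?thesis using coord_infinity_absorbed[OF assms(1) r'(2) calculation] by simp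
    next
      case (2 u)
      then have "r' \<le> u" using r(2) r' by (simp add: ennreal_less_iff)
      then show ?thesis using path_absorbed[OF assms(1) r'(2)] calculation 2 by simp
    qed
    ultimately show False using hit_attained[OF assms(1) Time] assms(2) by simp
  qed
  then show ?thesis using Time by simp
next
  case Beyond
  then show ?thesis by (cases "hit 0 \<omega>") auto
qed

text \<open>Intermediate values: a path starting below \<open>a\<close> cannot exceed \<open>a\<close> before hitting it, unless it
  jumps to \<open>\<infinity>\<close>.\<close>

lemma stopped_hit_le:
  assumes "\<omega> \<in> C_abs" "\<omega> 0 \<le> a" "t < \<infinity>" "coord t \<omega> \<noteq> \<infinity>"
  shows "stopped (hit a) t \<omega> \<le> a"
proof (rule ccontr)
  assume *: "\<not> ?thesis"
  obtain r where r: "0 \<le> r" "t = ennreal r" using assms(3) by (cases t) auto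
  have nothit: "\<not> hit a \<omega> \<le> Time t" and gt: "a \<le> \<omega> r"
    using * assms(1) r by (auto simp: stopped_hit split: if_splits)
  have "\<exists>u\<ge>0. u \<le> r \<and> \<omega> u = a"
    using assms r gt by (intro IVT' path_continuous_on) auto
  then show False using nothit hit_le_iff[OF assms(1) r(1)] r(2) by auto
qed

text \<open>A path that is finite at time \<open>t\<close> is bounded up to \<open>t\<close>, so that high levels are hit later.
  A path that is infinite at time \<open>t\<close> has, when stopped at \<open>T\<^sub>n\<close>, the value \<open>n\<close> there or, if it
  jumped over \<open>n\<close>, the value \<open>\<infinity>\<close>; both exceed a finite \<open>c\<close> for large \<open>n\<close>.\<close>

lemma eventually_less_stopped_iff:
  assumes "\<omega> \<in> C_abs" "0 \<le> t"
  shows "eventually (\<lambda>n::nat. c < stopped (hit (of_nat n)) (ennreal t) \<omega> \<longleftrightarrow> c < \<omega> t) sequentially"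
proof (cases "\<omega> t = \<infinity>")
  case True
  show ?thesis
  proof (cases c rule: ennreal_times)
    case (2 r)
    obtain N :: nat where "r < N" using reals_Archimedean2 by blast
    have "c < stopped (hit (of_nat n)) (ennreal t) \<omega> \<longleftrightarrow> c < \<omega> t" if "n \<ge> N" for n
    proof -
      have "c < of_nat n"
        using \<open>r < N\<close> that 2 by (simp add: ennreal_of_nat_eq_real_of_nat ennreal_less_iff)
      then show ?thesis using assms True 2 by (simp add: stopped_hit)
    qed
    then show ?thesis by (auto simp: eventually_sequentially)
  qed simp
next
  case False
  obtain u where u: "u \<in> {0..t}" "\<And>v. v \<in> {0..t} \<Longrightarrow> \<omega> v \<le> \<omega> u"
    using continuous_attains_sup[OF _ _ path_continuous_on[OF assms False]] assms(2) by auto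
  have "\<omega> u \<noteq> \<infinity>" using path_finite_before[OF assms(1) _ _ False] u by auto
  then obtain r where r: "\<omega> u = ennreal r" "0 \<le> r" by (cases "\<omega> u") auto
  obtain N :: nat where "r < N" using reals_Archimedean2 by blast
  have "stopped (hit (of_nat n)) (ennreal t) \<omega> = \<omega> t" if "n \<ge> N" for n
  proof -
    have "\<omega> u < of_nat n"
      using \<open>r < N\<close> that r by (simp add: ennreal_of_nat_eq_real_of_nat ennreal_less_iff)
    then have "\<not> hit (of_nat n) \<omega> \<le> Time (ennreal t)"
      using u hit_le_iff[OF assms] by (metis not_less)
    then show ?thesis using assms by (simp add: stopped_hit)
  qed
  then show ?thesis unfolding eventually_sequentially by metis
qed

section \<open>Measurability of coordinates and hitting times\<close>

lemma space_filt [simp]: "space (filt u) = C_abs"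
  unfolding filt_def by (intro space_measure_of) auto

lemma sets_filt:
  "sets (filt u) = sigma_sets C_abs
     {{\<omega> \<in> C_abs. coord s \<omega> \<in> B} | s B. s < \<infinity> \<and> Time s \<le> u \<and> B \<in> sets borel}"
  unfolding filt_def by (intro sets_measure_of) auto

lemma sets_filt_mono: "u \<le> v \<Longrightarrow> sets (filt u) \<subseteq> sets (filt v)"
  unfolding sets_filt by (intro sigma_sets_mono') (auto intro: order_trans)

lemma measurable_filt_mono: "u \<le> v \<Longrightarrow> f \<in> measurable (filt u) N \<Longrightarrow> f \<in> measurable (filt v) N"
  using sets_filt_mono[of u v] unfolding measurable_def by auto

lemma coord_measurable:
  assumes "s < \<infinity>" "Time s \<le> u"
  shows "coord s \<in> borel_measurable (filt u)"
proof (rule measurableI)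
  fix B :: "ennreal set" assume "B \<in> sets borel"
  then show "coord s -` B \<inter> space (filt u) \<in> sets (filt u)"
    unfolding sets_filt using assms by (intro sigma_sets.Basic) auto
qed simp

lemma path_measurable:
  assumes "0 \<le> r" "Time (ennreal r) \<le> u"
  shows "(\<lambda>\<omega>. \<omega> r) \<in> borel_measurable (filt u)"
  using coord_measurable[of "ennreal r" u] assms by (subst measurable_cong[where g="coord (ennreal r)"]) auto

lemma filt_measurableI:
  assumes "sets P = sets (filt Beyond)" "f \<in> measurable (filt u) N"
  shows "f \<in> measurable P N"
  unfolding measurable_cong_sets[OF assms(1) refl] using le_Beyond assms(2) by (rule measurable_filt_mono)

text \<open>Right-continuity reduces suprema and infima over a time interval to countably many rational
  times and so makes them measurable.\<close>

lemma SUP_INF_right_dense: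
  fixes f :: "real \<Rightarrow> ennreal"
  assumes "D \<subseteq> S"
    and dense: "\<And>u. u \<in> S \<Longrightarrow> u \<in> D \<or> (f \<longlongrightarrow> f u) (at_right u) \<and> frequently (\<lambda>v. v \<in> D) (at_right u)"
  shows "(SUP u\<in>D. f u) = (SUP u\<in>S. f u)" "(INF u\<in>D. f u) = (INF u\<in>S. f u)"
proof -
  have near: "\<exists>v\<in>D. Q (f v)" if "u \<in> S" "Q (f u)" "open {x. Q x}" for u Q
  proof (cases "u \<in> D")
    case True then show ?thesis using that by blast
  next
    case False
    then have "(f \<longlongrightarrow> f u) (at_right u)" "frequently (\<lambda>v. v \<in> D) (at_right u)"
      using dense that(1) by blast+
    moreover from this(1) have "eventually (\<lambda>v. Q (f v)) (at_right u)"
      using topological_tendstoD[of f "f u" "at_right u" "{x. Q x}"] that by simp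
    ultimately have "frequently (\<lambda>v. v \<in> D \<and> Q (f v)) (at_right u)"
      by (simp add: eventually_frequently_simps frequently_eventually_conj conj_commute)
    then show ?thesis by (blast dest: frequently_ex)
  qed
  show "(SUP u\<in>D. f u) = (SUP u\<in>S. f u)"
  proof (rule antisym)
    show "(SUP u\<in>D. f u) \<le> (SUP u\<in>S. f u)" using assms(1) by (intro SUP_subset_mono) auto
    show "(SUP u\<in>S. f u) \<le> (SUP u\<in>D. f u)"
    proof (intro SUP_least le_SUP_iff[THEN iffD2] allI impI)
      fix u y assume "u \<in> S" "y < f u"
      then show "\<exists>v\<in>D. y < f v"
        using near[of u "\<lambda>x. y < x"] open_greaterThan[of y] by (simp add: greaterThan_def)
    qed
  qed
  show "(INF u\<in>D. f u) = (INF u\<in>S. f u)"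
  proof (rule antisym)
    show "(INF u\<in>S. f u) \<le> (INF u\<in>D. f u)" using assms(1) by (intro INF_superset_mono) auto
    show "(INF u\<in>D. f u) \<le> (INF u\<in>S. f u)"
    proof (intro INF_greatest INF_le_iff[THEN iffD2] allI impI)
      fix u y assume "u \<in> S" "f u < y"
      then show "\<exists>v\<in>D. f v < y"
        using near[of u "\<lambda>x. x < y"] open_lessThan[of y] by (simp add: lessThan_def)
    qed
  qed
qed

lemma frequently_rational_at_right:
  fixes u r :: real
  assumes "u < r"
  shows "frequently (\<lambda>v. v \<in> \<rat> \<and> u < v \<and> v < r) (at_right u)"
  unfolding frequently_def eventually_at_right_field not_ex not_all
proof (intro allI notI)
  fix b assume "b > u \<and> (\<forall>y>u. y < b \<longrightarrow> \<not> (y \<in> \<rat> \<and> u < y \<and> y < r))"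
  moreover obtain q where "q \<in> \<rat>" "u < q" "q < min b r"
    using Rats_dense_in_real[of u "min b r"] calculation assms by auto
  ultimately show False by auto
qed

lemma Limsup_Liminf_at_top_SUP:
  fixes f :: "real \<Rightarrow> ennreal"
  shows "Limsup at_top f = (INF n::nat. SUP u\<in>{real n..}. f u)"
    "Liminf at_top f = (SUP n::nat. INF u\<in>{real n..}. f u)"
proof -
  have ge: "eventually (\<lambda>u. u \<in> {real n..}) at_top" for n
    by (simp add: eventually_ge_at_top)
  have n: "\<exists>n. {real n..} \<subseteq> Collect P" if ev: "eventually P at_top" for P
  proof -
    obtain N where "\<forall>u\<ge>N. P u" using ev unfolding eventually_at_top_linorder by blast
    moreover obtain n :: nat where "N \<le> n" using real_arch_simple by blast
    ultimately show ?thesis by (intro exI[of _ n]) auto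
  qed
  show "Limsup at_top f = (INF n::nat. SUP u\<in>{real n..}. f u)"
    unfolding Limsup_def
  proof (intro antisym INF_greatest)
    fix n :: nat show "(INF P\<in>{P. eventually P at_top}. SUP u\<in>Collect P. f u) \<le> (SUP u\<in>{real n..}. f u)"
      using ge[of n] by (intro INF_lower2[of "\<lambda>u. u \<in> {real n..}"]) (auto simp: atLeast_def)
  next
    fix P :: "real \<Rightarrow> bool" assume "P \<in> {P. eventually P at_top}"
    then obtain n :: nat where "{real n..} \<subseteq> Collect P" using n by blast
    then show "(INF n::nat. SUP u\<in>{real n..}. f u) \<le> (SUP u\<in>Collect P. f u)"
      by (intro INF_lower2[of n] SUP_subset_mono) auto
  qed
  show "Liminf at_top f = (SUP n::nat. INF u\<in>{real n..}. f u)"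
    unfolding Liminf_def
  proof (intro antisym SUP_least)
    fix n :: nat show "(INF u\<in>{real n..}. f u) \<le> (SUP P\<in>{P. eventually P at_top}. INF u\<in>Collect P. f u)"
      using ge[of n] by (intro SUP_upper2[of "\<lambda>u. u \<in> {real n..}"]) (auto simp: atLeast_def)
  next
    fix P :: "real \<Rightarrow> bool" assume "P \<in> {P. eventually P at_top}"
    then obtain n :: nat where "{real n..} \<subseteq> Collect P" using n by blast
    then show "(INF u\<in>Collect P. f u) \<le> (SUP n::nat. INF u\<in>{real n..}. f u)"
      by (intro SUP_upper2[of n] INF_superset_mono) auto
  qed
qed

lemma countable_rational_subset [simp]: "countable (\<rat> \<inter> A)" for A :: "real set"
  using countable_rat by (rule countable_Int1)

lemma coord_infinity_measurable: "coord_infinity \<in> borel_measurable (filt Beyond)"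
proof -
  have sup_rat: "(SUP q\<in>\<rat> \<inter> {real n..}. \<omega> q) = (SUP u\<in>{real n..}. \<omega> u)"
    and inf_rat: "(INF q\<in>\<rat> \<inter> {real n..}. \<omega> q) = (INF u\<in>{real n..}. \<omega> u)" if "\<omega> \<in> C_abs" for \<omega> n
  proof -
    have *: "(\<omega> \<longlongrightarrow> \<omega> u) (at_right u) \<and> frequently (\<lambda>v. v \<in> \<rat> \<inter> {real n..}) (at_right u)"
      if "u \<in> {real n..}" for u
      using path_right_continuous[OF \<open>\<omega> \<in> C_abs\<close>, of u] frequently_rational_at_right[of u "u + 1"] that
      by (auto elim!: frequently_mono[rotated])
    show "(SUP q\<in>\<rat> \<inter> {real n..}. \<omega> q) = (SUP u\<in>{real n..}. \<omega> u)"
      "(INF q\<in>\<rat> \<inter> {real n..}. \<omega> q) = (INF u\<in>{real n..}. \<omega> u)"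
      using * by (intro SUP_INF_right_dense; blast)+
  qed
  have meas: "(\<lambda>\<omega>. \<omega> q) \<in> borel_measurable (filt Beyond)" if "q \<in> \<rat> \<inter> {real n..}" for q n
    using that by (intro path_measurable) (auto intro: order_trans[of 0 "real n"])
  have [measurable]: "(\<lambda>\<omega>. SUP q\<in>\<rat> \<inter> {real n..}. \<omega> q) \<in> borel_measurable (filt Beyond)"
    "(\<lambda>\<omega>. INF q\<in>\<rat> \<inter> {real n..}. \<omega> q) \<in> borel_measurable (filt Beyond)" for n
    by (intro borel_measurable_SUP borel_measurable_INF meas countable_rational_subset; assumption)+
  have [measurable]: "(\<lambda>\<omega>. Limsup at_top \<omega>) \<in> borel_measurable (filt Beyond)"
    by (subst measurable_cong[where g="\<lambda>\<omega>. INF n::nat. SUP q\<in>\<rat> \<inter> {real n..}. \<omega> q"])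
       (simp_all add: Limsup_Liminf_at_top_SUP sup_rat)
  have [measurable]: "(\<lambda>\<omega>. Liminf at_top \<omega>) \<in> borel_measurable (filt Beyond)"
    by (subst measurable_cong[where g="\<lambda>\<omega>. SUP n::nat. INF q\<in>\<rat> \<inter> {real n..}. \<omega> q"])
       (simp_all add: Limsup_Liminf_at_top_SUP inf_rat)
  have [measurable]: "ennreal_sqrt \<in> borel_measurable borel"
    unfolding ennreal_sqrt_def by measurable
  show ?thesis unfolding coord_infinity_def by measurable
qed

lemma coord_measurable_Beyond: "coord t \<in> borel_measurable (filt Beyond)"
  using coord_measurable[of t Beyond] coord_infinity_measurable
  by (cases "t = \<infinity>") (auto simp: less_top coord_def[abs_def] cong: if_cong)

text \<open>Up to a time at which the path is finite it takes exactly the values between its extrema,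
  and these are determined by countably many coordinates. The time \<open>q\<close>, at which the path is still finite,
  is needed because a path that jumps to \<open>\<infinity>\<close> may approach a level without attaining it.\<close>

lemma hit_le_iff_rational:
  assumes "\<omega> \<in> C_abs" "0 \<le> r" "a \<noteq> \<infinity>"
  defines "D \<equiv> \<lambda>q. insert q (\<rat> \<inter> {0..q})"
  shows "hit a \<omega> \<le> Time (ennreal r) \<longleftrightarrow>
    (\<exists>q\<in>D r. \<omega> q \<noteq> \<infinity> \<and> (INF v\<in>D q. \<omega> v) \<le> a \<and> a \<le> (SUP v\<in>D q. \<omega> v))"
proof -
  have finite: "(INF v\<in>D q. \<omega> v) \<le> a \<and> a \<le> (SUP v\<in>D q. \<omega> v) \<longleftrightarrow> (\<exists>u\<in>{0..q}. \<omega> u = a)"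
    if q: "0 \<le> q" "\<omega> q \<noteq> \<infinity>" for q
  proof -
    have dense: "u \<in> D q \<or> (\<omega> \<longlongrightarrow> \<omega> u) (at_right u) \<and> frequently (\<lambda>v. v \<in> D q) (at_right u)"
      if "u \<in> {0..q}" for u
    proof (cases "u = q")
      case False
      then have "frequently (\<lambda>v. v \<in> \<rat> \<and> u < v \<and> v < q) (at_right u)"
        using that by (intro frequently_rational_at_right) auto
      then have "frequently (\<lambda>v. v \<in> D q) (at_right u)"
        by (rule frequently_elim1) (use that in \<open>auto simp: D_def\<close>)
      then show ?thesis using path_right_continuous[OF \<open>\<omega> \<in> C_abs\<close>, of u] that by auto
    qed (simp add: D_def)
    have "D q \<subseteq> {0..q}" using q by (auto simp: D_def)
    note eq = SUP_INF_right_dense[OF this dense]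
    have cont: "continuous_on {0..q} \<omega>" using path_continuous_on assms(1) q by blast
    show ?thesis
    proof
      assume "(INF v\<in>D q. \<omega> v) \<le> a \<and> a \<le> (SUP v\<in>D q. \<omega> v)"
      then have le: "(INF v\<in>{0..q}. \<omega> v) \<le> a" "a \<le> (SUP v\<in>{0..q}. \<omega> v)" using eq by auto
      obtain x where x: "x \<in> {0..q}" "\<And>v. v \<in> {0..q} \<Longrightarrow> \<omega> v \<le> \<omega> x"
        using continuous_attains_sup[OF _ _ cont] q by auto
      obtain y where y: "y \<in> {0..q}" "\<And>v. v \<in> {0..q} \<Longrightarrow> \<omega> y \<le> \<omega> v"
        using continuous_attains_inf[OF _ _ cont] q by auto
      have "(SUP v\<in>{0..q}. \<omega> v) \<le> \<omega> x" "\<omega> y \<le> (INF v\<in>{0..q}. \<omega> v)"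
        using x y by (auto intro: SUP_least INF_greatest)
      then have "\<omega> y \<le> a" "a \<le> \<omega> x" using le by auto
      moreover have "connected (\<omega> ` {0..q})" using cont by (intro connected_continuous_image) auto
      ultimately have "a \<in> \<omega> ` {0..q}" using x y by (blast intro: connectedD_interval)
      then show "\<exists>u\<in>{0..q}. \<omega> u = a" by auto
    next
      assume "\<exists>u\<in>{0..q}. \<omega> u = a"
      then show "(INF v\<in>D q. \<omega> v) \<le> a \<and> a \<le> (SUP v\<in>D q. \<omega> v)"
        using eq INF_lower[of _ "{0..q}" \<omega>] SUP_upper[of _ "{0..q}" \<omega>] by fastforce
    qed
  qed
  show ?thesis unfolding hit_le_iff[OF assms(1,2)]
  proof
    assume "\<exists>u\<in>{0..r}. \<omega> u = a"
    then obtain u where u: "0 \<le> u" "u \<le> r" "\<omega> u = a" by auto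
    obtain q where "q \<in> D r" "u \<le> q" "\<omega> q \<noteq> \<infinity>"
    proof (cases "u = r")
      case True then show ?thesis using that[of r] u assms(3) by (simp add: D_def)
    next
      case False
      obtain r' where r': "r' > u" "\<omega> r' \<noteq> \<infinity>" using path_finite_after assms u by metis
      obtain q where q: "q \<in> \<rat>" "u < q" "q < min r r'"
        using Rats_dense_in_real[of u "min r r'"] r'(1) u False by auto
      then show ?thesis using that[of q] path_finite_before[OF assms(1), of q r'] r' u
        by (auto simp: D_def)
    qed
    moreover from this have "0 \<le> q" using u by simp
    ultimately show "\<exists>q\<in>D r. \<omega> q \<noteq> \<infinity> \<and> (INF v\<in>D q. \<omega> v) \<le> a \<and> a \<le> (SUP v\<in>D q. \<omega> v)"
      using finite[of q] u by (intro bexI[of _ q]) auto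
  next
    assume "\<exists>q\<in>D r. \<omega> q \<noteq> \<infinity> \<and> (INF v\<in>D q. \<omega> v) \<le> a \<and> a \<le> (SUP v\<in>D q. \<omega> v)"
    then obtain q where q: "q \<in> D r" "\<omega> q \<noteq> \<infinity>" "(INF v\<in>D q. \<omega> v) \<le> a \<and> a \<le> (SUP v\<in>D q. \<omega> v)"
      by blast
    moreover have "0 \<le> q" "q \<le> r" using q(1) assms(2) by (auto simp: D_def)
    ultimately show "\<exists>u\<in>{0..r}. \<omega> u = a" using finite[of q] by auto
  qed
qed

lemma stopping_time_hit:
  assumes "a \<noteq> \<infinity>"
  shows "stopping_time filt (hit a)"
  unfolding stopping_time_def
proof
  have finite: "Measurable.pred (filt (Time (ennreal r))) (\<lambda>\<omega>. hit a \<omega> \<le> Time (ennreal r))"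
    if r: "0 \<le> r" for r
  proof -
    let ?D = "\<lambda>q. insert q (\<rat> \<inter> {0..q})"
    have q: "0 \<le> q" "q \<le> r" if "q \<in> ?D r" for q using r that by auto
    have meas: "(\<lambda>\<omega>. \<omega> v) \<in> borel_measurable (filt (Time (ennreal r)))" if "0 \<le> v" "v \<le> r" for v
      using that by (intro path_measurable) (auto simp: ennreal_leI)
    have extrema: "(\<lambda>\<omega>. INF v\<in>?D q. \<omega> v) \<in> borel_measurable (filt (Time (ennreal r)))"
      "(\<lambda>\<omega>. SUP v\<in>?D q. \<omega> v) \<in> borel_measurable (filt (Time (ennreal r)))"
      "(\<lambda>\<omega>. \<omega> q) \<in> borel_measurable (filt (Time (ennreal r)))" if "q \<in> ?D r" for q
    proof -
      have *: "(\<lambda>\<omega>. \<omega> v) \<in> borel_measurable (filt (Time (ennreal r)))" if "v \<in> ?D q" for v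
        using that q[OF \<open>q \<in> ?D r\<close>] by (intro meas) auto
      show "(\<lambda>\<omega>. INF v\<in>?D q. \<omega> v) \<in> borel_measurable (filt (Time (ennreal r)))"
        by (rule borel_measurable_INF[OF _ *]) simp_all
      show "(\<lambda>\<omega>. SUP v\<in>?D q. \<omega> v) \<in> borel_measurable (filt (Time (ennreal r)))"
        by (rule borel_measurable_SUP[OF _ *]) simp_all
      show "(\<lambda>\<omega>. \<omega> q) \<in> borel_measurable (filt (Time (ennreal r)))" by (rule *) simp
    qed
    have "countable (?D r)" by simp
    have "Measurable.pred (filt (Time (ennreal r)))
       (\<lambda>\<omega>. \<exists>q\<in>?D r. \<omega> q \<noteq> \<infinity> \<and> (INF v\<in>?D q. \<omega> v) \<le> a \<and> a \<le> (SUP v\<in>?D q. \<omega> v))"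
      unfolding pred_def
    proof (rule sets.sets_Collect_countable_Ex'[OF _ \<open>countable (?D r)\<close>])
      fix q assume "q \<in> ?D r"
      have "{\<omega>\<in>space (filt (Time (ennreal r))). f \<omega> \<noteq> \<infinity> \<and> g \<omega> \<le> a \<and> a \<le> h \<omega>} \<in> sets (filt (Time (ennreal r)))"
        if [measurable]: "f \<in> borel_measurable (filt (Time (ennreal r)))"
          "g \<in> borel_measurable (filt (Time (ennreal r)))" "h \<in> borel_measurable (filt (Time (ennreal r)))"
        for f g h :: "path \<Rightarrow> ennreal" by measurable
      from this[OF extrema(3,1,2)] \<open>q \<in> ?D r\<close>
      show "{\<omega>\<in>space (filt (Time (ennreal r))). \<omega> q \<noteq> \<infinity> \<and> (INF v\<in>?D q. \<omega> v) \<le> a \<and>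
          a \<le> (SUP v\<in>?D q. \<omega> v)} \<in> sets (filt (Time (ennreal r)))" by blast
    qed
    then show ?thesis
      by (subst measurable_cong) (use hit_le_iff_rational[OF _ r assms] in auto)
  qed
  fix t show "Measurable.pred (filt t) (\<lambda>\<omega>. hit a \<omega> \<le> t)"
  proof (cases t)
    case (Time s)
    show ?thesis
    proof (cases s rule: ennreal_times)
      case 1
      have iff: "hit a \<omega> \<le> Time \<infinity> \<longleftrightarrow>
          (\<exists>n::nat. hit a \<omega> \<le> Time (ennreal (real n))) \<or> coord_infinity \<omega> = a" if "\<omega> \<in> C_abs" for \<omega>
      proof -
        have "(\<exists>u\<ge>0. \<omega> u = a) \<longleftrightarrow> (\<exists>n::nat. \<exists>u\<in>{0..real n}. \<omega> u = a)"
          using real_arch_simple by fastforce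
        then show ?thesis unfolding hit_le_infinity_iff using that by (simp add: hit_le_iff)
      qed
      have eq: "sets (filt (Time \<infinity>)) = sets (filt Beyond)"
        unfolding sets_filt by simp
      have "coord_infinity \<in> borel_measurable (filt (Time \<infinity>))"
        using coord_infinity_measurable measurable_cong_sets[OF eq refl] by blast
      then have "Measurable.pred (filt (Time \<infinity>)) (\<lambda>\<omega>. coord_infinity \<omega> = a)"
        by measurable
      moreover have "Measurable.pred (filt (Time \<infinity>)) (\<lambda>\<omega>. hit a \<omega> \<le> Time (ennreal (real n)))" for n :: nat
        by (rule measurable_filt_mono[OF _ finite]) auto
      ultimately have "Measurable.pred (filt (Time \<infinity>)) (\<lambda>\<omega>.
          (\<exists>n::nat. hit a \<omega> \<le> Time (ennreal (real n))) \<or> coord_infinity \<omega> = a)"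
        by measurable
      then show ?thesis
        unfolding Time 1 by (subst measurable_cong) (use iff in auto)
    next
      case (2 r) then show ?thesis using finite Time by simp
    qed
  qed simp
qed

lemma sets_filt_atI:
  assumes "A \<in> sets (filt Beyond)"
    and "\<And>t. t < \<infinity> \<Longrightarrow> A \<inter> {\<omega>. \<tau> \<omega> \<le> Time t} \<in> sets (filt (Time t))"
  shows "A \<in> sets (filt_at \<tau>)"
proof -
  have "{A \<in> sets (filt Beyond). \<forall>t<\<infinity>. A \<inter> {\<omega>. \<tau> \<omega> \<le> Time t} \<in> sets (filt (Time t))} \<subseteq> Pow C_abs"
    using sets.space_closed[of "filt Beyond"] by auto
  then show ?thesis unfolding filt_at_def using assms by simp
qed

lemma sets_filt_at_subset: "A \<in> sets (filt_at \<tau>) \<Longrightarrow> A \<in> sets (filt Beyond)"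
proof -
  let ?G = "{A \<in> sets (filt Beyond). \<forall>t<\<infinity>. A \<inter> {\<omega>. \<tau> \<omega> \<le> Time t} \<in> sets (filt (Time t))}"
  have "?G \<subseteq> Pow C_abs"
    using sets.space_closed[of "filt Beyond"] by auto
  moreover assume "A \<in> sets (filt_at \<tau>)"
  ultimately have "A \<in> sigma_sets C_abs ?G" by (simp add: filt_at_def)
  also have "\<dots> \<subseteq> sets (filt Beyond)"
    using sets.sigma_sets_subset[of ?G "filt Beyond"] by auto
  finally show ?thesis .
qed

lemma pred_hit_le:
  assumes "a \<noteq> \<infinity>" "Time t \<le> u"
  shows "Measurable.pred (filt u) (\<lambda>\<omega>. hit a \<omega> \<le> Time t)"
  using assms stopping_time_hit[OF assms(1)]
  by (auto intro: measurable_filt_mono simp: stopping_time_def)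

lemma stopped_hit_measurable:
  assumes "a \<noteq> \<infinity>" "t < \<infinity>" "Time t \<le> u"
  shows "stopped (hit a) t \<in> borel_measurable (filt u)"
proof -
  note [measurable] = pred_hit_le[OF assms(1,3)] coord_measurable[OF assms(2,3)]
  show ?thesis
    by (subst measurable_cong[where g="\<lambda>\<omega>. if hit a \<omega> \<le> Time t then a else coord t \<omega>"])
      (simp_all add: stopped_hit)
qed

text \<open>Where \<open>T\<^sub>a \<le> u\<close>, the stopped process at time \<open>t\<close> is its value at time \<open>min t u\<close>, which is
  known at time \<open>u\<close>.\<close>

lemma stopped_hit_filt_at:
  assumes "a \<noteq> \<infinity>" "t < \<infinity>"
  shows "{\<omega>\<in>C_abs. c < stopped (hit a) t \<omega>} \<in> sets (filt_at (hit a))"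
proof (rule sets_filt_atI)
  note [measurable] = stopped_hit_measurable[OF assms le_Beyond]
  show "{\<omega>\<in>C_abs. c < stopped (hit a) t \<omega>} \<in> sets (filt Beyond)"
    using borel_measurable_pred_less[of "\<lambda>_. c" "filt Beyond" "stopped (hit a) t"] by (simp add: pred_def)
next
  fix u :: ennreal assume u: "u < \<infinity>"
  have [measurable]: "stopped (hit a) (min t u) \<in> borel_measurable (filt (Time u))"
    using assms u by (intro stopped_hit_measurable) (auto simp: min_less_iff_disj)
  note [measurable] = pred_hit_le[OF assms(1), of u "Time u"]
  have "{\<omega>\<in>C_abs. c < stopped (hit a) t \<omega>} \<inter> {\<omega>. hit a \<omega> \<le> Time u} =
    {\<omega>\<in>space (filt (Time u)). c < stopped (hit a) (min t u) \<omega> \<and> hit a \<omega> \<le> Time u}"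
  proof -
    have "stopped (hit a) t \<omega> = stopped (hit a) (min t u) \<omega>" if le: "hit a \<omega> \<le> Time u" for \<omega>
    proof (cases "hit a \<omega>")
      case (Time s)
      then have "min s t = min s (min t u)" using le by (auto simp: min_def)
      then show ?thesis using Time by (simp add: stopped_def)
    qed (use le in simp)
    then show ?thesis by auto
  qed
  also have "\<dots> \<in> sets (filt (Time u))" by measurable
  finally show "{\<omega>\<in>C_abs. c < stopped (hit a) t \<omega>} \<inter> {\<omega>. hit a \<omega> \<le> Time u} \<in> sets (filt (Time u))" .
qed

lemma hit_le_infinity_filt_at:
  assumes "a \<noteq> \<infinity>"
  shows "{\<omega>\<in>C_abs. hit a \<omega> \<le> Time \<infinity>} \<in> sets (filt_at (hit a))"
proof (rule sets_filt_atI)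
  show "{\<omega>\<in>C_abs. hit a \<omega> \<le> Time \<infinity>} \<in> sets (filt Beyond)"
    using pred_hit_le[OF assms, of \<infinity> Beyond] by (simp add: pred_def)
  fix t
  have "{\<omega>\<in>C_abs. hit a \<omega> \<le> Time \<infinity>} \<inter> {\<omega>. hit a \<omega> \<le> Time t} = {\<omega>\<in>C_abs. hit a \<omega> \<le> Time t}"
    by (auto intro: order_trans)
  then show "{\<omega>\<in>C_abs. hit a \<omega> \<le> Time \<infinity>} \<inter> {\<omega>. hit a \<omega> \<le> Time t} \<in> sets (filt (Time t))"
    using pred_hit_le[OF assms, of t "Time t"] by (simp add: pred_def)
qed

section \<open>Martingales and optional stopping\<close>

lemma subalgebra_filt: "sets P = sets (filt Beyond) \<Longrightarrow> subalgebra P (filt u)"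
  using sets_filt_mono[of u Beyond] sets_eq_imp_space_eq[of P "filt Beyond"]
  by (simp add: subalgebra_def)

lemma sigma_finite_subalgebra_filt:
  assumes "prob_space P" "sets P = sets (filt Beyond)"
  shows "sigma_finite_subalgebra P (filt u)"
proof -
  interpret prob_space P by fact
  interpret finite_measure_subalgebra P "filt u"
    using subalgebra_filt[OF assms(2)] by unfold_locales
  show ?thesis by unfold_locales
qed

lemma nonneg_martingale_nn_integral:
  assumes P: "prob_space P" "sets P = sets (filt Beyond)"
    and Y: "nonneg_martingale P Y"
    and "s \<le> t" "t < \<infinity>" "A \<in> sets (filt (Time s))"
  shows "(\<integral>\<^sup>+\<omega>\<in>A. Y t \<omega> \<partial>P) = (\<integral>\<^sup>+\<omega>\<in>A. Y s \<omega> \<partial>P)"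
proof -
  interpret sigma_finite_subalgebra P "filt (Time s)"
    by (rule sigma_finite_subalgebra_filt[OF P])
  have [measurable]: "Y t \<in> borel_measurable P"
    using Y assms(5) by (intro filt_measurableI[OF P(2)]) (auto simp: nonneg_martingale_def)
  have [measurable]: "A \<in> sets (filt (Time s))" by fact
  have "(\<integral>\<^sup>+\<omega>\<in>A. Y t \<omega> \<partial>P) = (\<integral>\<^sup>+\<omega>. indicator A \<omega> * Y t \<omega> \<partial>P)" by (simp add: mult.commute)
  also have "\<dots> = (\<integral>\<^sup>+\<omega>. indicator A \<omega> * nn_cond_exp P (filt (Time s)) (Y t) \<omega> \<partial>P)"
    by (rule nn_cond_exp_intg[symmetric]) auto
  also have "\<dots> = (\<integral>\<^sup>+\<omega>. indicator A \<omega> * Y s \<omega> \<partial>P)"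
  proof (rule nn_integral_cong_AE)
    have "AE \<omega> in P. nn_cond_exp P (filt (Time s)) (Y t) \<omega> = Y s \<omega>"
      using Y assms(4,5) by (simp add: nonneg_martingale_def)
    then show "AE \<omega> in P. indicator A \<omega> * nn_cond_exp P (filt (Time s)) (Y t) \<omega> = indicator A \<omega> * Y s \<omega>"
      by auto
  qed
  finally show ?thesis by (simp add: mult.commute)
qed

lemma nonneg_martingaleI:
  assumes P: "prob_space P" "sets P = sets (filt Beyond)"
    and meas: "\<And>t. t < \<infinity> \<Longrightarrow> Y t \<in> borel_measurable (filt (Time t))"
    and int: "\<And>t. t < \<infinity> \<Longrightarrow> (\<integral>\<^sup>+\<omega>. Y t \<omega> \<partial>P) < \<infinity>"
    and mart: "\<And>s t A. s \<le> t \<Longrightarrow> t < \<infinity> \<Longrightarrow> A \<in> sets (filt (Time s)) \<Longrightarrow>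
      (\<integral>\<^sup>+\<omega>\<in>A. Y t \<omega> \<partial>P) = (\<integral>\<^sup>+\<omega>\<in>A. Y s \<omega> \<partial>P)"
  shows "nonneg_martingale P Y"
  unfolding nonneg_martingale_def
proof (intro conjI allI impI)
  fix s t :: ennreal assume st: "s \<le> t" "t < \<infinity>"
  interpret sigma_finite_subalgebra P "filt (Time s)"
    by (rule sigma_finite_subalgebra_filt[OF P])
  have "AE \<omega> in P. Y s \<omega> = nn_cond_exp P (filt (Time s)) (Y t) \<omega>"
    using mart[OF st] st meas[of s] filt_measurableI[OF P(2) meas[of t]]
    by (intro nn_cond_exp_charact) (auto intro: le_less_trans)
  then show "AE \<omega> in P. nn_cond_exp P (filt (Time s)) (Y t) \<omega> = Y s \<omega>" by auto
qed (use meas int in auto)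

lemma bounded_uniformly_integrable:
  assumes "\<And>t. t < \<infinity> \<Longrightarrow> AE \<omega> in P. Y t \<omega> \<le> ennreal a"
  shows "uniformly_integrable P Y"
  unfolding uniformly_integrable_def
proof (rule tendsto_eventually)
  have zero: "(\<integral>\<^sup>+\<omega>\<in>{\<omega>. ennreal K \<le> Y t \<omega>}. Y t \<omega> \<partial>P) = 0" if "max a 0 < K" "t < \<infinity>" for K t
  proof -
    have lt: "ennreal a < ennreal K" using that(1) by (auto simp: ennreal_less_iff ennreal_lessI)
    have "AE \<omega> in P. Y t \<omega> * indicator {\<omega>. ennreal K \<le> Y t \<omega>} \<omega> = 0"
      using assms[OF that(2)] by (rule eventually_mono) (use lt in \<open>auto simp: indicator_def\<close>)
    then have "(\<integral>\<^sup>+\<omega>\<in>{\<omega>. ennreal K \<le> Y t \<omega>}. Y t \<omega> \<partial>P) = (\<integral>\<^sup>+\<omega>. 0 \<partial>P)"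
      by (rule nn_integral_cong_AE)
    then show ?thesis by simp
  qed
  show "eventually (\<lambda>K::real. (SUP t\<in>{..<\<infinity>}. (\<integral>\<^sup>+\<omega>\<in>{\<omega>. ennreal K \<le> Y t \<omega>}. Y t \<omega> \<partial>P)) = 0) at_top"
    using eventually_gt_at_top[of "max a 0"]
  proof eventually_elim
    case (elim K)
    have "(SUP t\<in>{..<\<infinity>}. (\<integral>\<^sup>+\<omega>\<in>{\<omega>. ennreal K \<le> Y t \<omega>}. Y t \<omega> \<partial>P)) \<le> 0"
      using zero[OF elim] by (intro SUP_least) auto
    then show ?case by simp
  qed
qed

text \<open>\<open>grid_time G t \<sigma>\<close> rounds \<open>min \<sigma> t\<close> up to the next point of the finite grid \<open>G\<close>, which has
  maximum \<open>t\<close>.\<close>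

definition grid_time :: "real set \<Rightarrow> real \<Rightarrow> (path \<Rightarrow> etime) \<Rightarrow> path \<Rightarrow> real" where
  "grid_time G t \<sigma> \<omega> = Min {v \<in> G. \<sigma> \<omega> \<le> Time (ennreal v) \<or> v = t}"

lemma grid_time_mem:
  assumes "finite G" "t \<in> G"
  shows "grid_time G t \<sigma> \<omega> \<in> {v \<in> G. \<sigma> \<omega> \<le> Time (ennreal v) \<or> v = t}"
  unfolding grid_time_def using assms by (intro Min_in) auto

lemma grid_time_le:
  assumes "finite G" "v \<in> G" "\<sigma> \<omega> \<le> Time (ennreal v) \<or> v = t"
  shows "grid_time G t \<sigma> \<omega> \<le> v"
  unfolding grid_time_def using assms by (intro Min_le) auto

lemma pred_grid_time:
  assumes "finite G" "t \<in> G" "G \<subseteq> {0..t}" "stopping_time filt \<sigma>" "v \<in> G"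
  shows "Measurable.pred (filt (Time (ennreal v))) (\<lambda>\<omega>. grid_time G t \<sigma> \<omega> = v)"
proof -
  have pred: "Measurable.pred (filt (Time (ennreal v))) (\<lambda>\<omega>. \<sigma> \<omega> \<le> Time (ennreal w))" if "w \<le> v" for w
    by (rule measurable_filt_mono[of "Time (ennreal w)"])
      (use assms(4) that in \<open>auto simp: stopping_time_def ennreal_leI\<close>)
  have "grid_time G t \<sigma> \<omega> = v \<longleftrightarrow>
      (\<sigma> \<omega> \<le> Time (ennreal v) \<or> v = t) \<and> (\<forall>w\<in>{w\<in>G. w < v}. \<not> \<sigma> \<omega> \<le> Time (ennreal w))" for \<omega>
  proof -
    have "v \<le> t" using assms(3,5) by auto
    have "finite {v \<in> G. \<sigma> \<omega> \<le> Time (ennreal v) \<or> v = t}" "{v \<in> G. \<sigma> \<omega> \<le> Time (ennreal v) \<or> v = t} \<noteq> {}"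
      using assms(1,2) by auto
    then have "grid_time G t \<sigma> \<omega> = v \<longleftrightarrow> v \<in> {v \<in> G. \<sigma> \<omega> \<le> Time (ennreal v) \<or> v = t} \<and>
        (\<forall>w\<in>{v \<in> G. \<sigma> \<omega> \<le> Time (ennreal v) \<or> v = t}. v \<le> w)"
      unfolding grid_time_def by (rule Min_eq_iff)
    also have "(\<forall>w\<in>{v \<in> G. \<sigma> \<omega> \<le> Time (ennreal v) \<or> v = t}. v \<le> w) \<longleftrightarrow>
        (\<forall>w\<in>{w\<in>G. w < v}. \<not> \<sigma> \<omega> \<le> Time (ennreal w))"
      using \<open>v \<le> t\<close> by (force simp: not_less)
    finally show ?thesis using \<open>v \<in> G\<close> by simp
  qed
  moreover have "Measurable.pred (filt (Time (ennreal v))) (\<lambda>\<omega>.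
      (\<sigma> \<omega> \<le> Time (ennreal v) \<or> v = t) \<and> (\<forall>w\<in>{w\<in>G. w < v}. \<not> \<sigma> \<omega> \<le> Time (ennreal w)))"
    using assms(1) pred by (intro pred_intros_logic pred_intros_finite) auto
  ultimately show ?thesis by simp
qed

text \<open>Optional sampling at a time \<open>\<rho> \<le> t\<close> with finitely many values \<open>v\<close>: on each event
  \<open>\<rho> = v\<close> the martingale property is used between \<open>v\<close> and \<open>t\<close>.\<close>

lemma nn_integral_finite_sampling:
  fixes \<rho> :: "path \<Rightarrow> real"
  assumes P: "prob_space P" "sets P = sets (filt Beyond)"
    and Y: "nonneg_martingale P Y"
    and V: "finite V" "V \<subseteq> {0..t}" "\<And>\<omega>. \<omega> \<in> C \<Longrightarrow> \<rho> \<omega> \<in> V"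
    and C: "\<And>v. v \<in> V \<Longrightarrow> C \<inter> {\<omega>. \<rho> \<omega> = v} \<in> sets (filt (Time (ennreal v)))"
  shows "(\<integral>\<^sup>+\<omega>\<in>C. Y (ennreal (\<rho> \<omega>)) \<omega> \<partial>P) = (\<integral>\<^sup>+\<omega>\<in>C. Y (ennreal t) \<omega> \<partial>P)"
proof -
  let ?C = "\<lambda>v. C \<inter> {\<omega>. \<rho> \<omega> = v}"
  have Ysets: "?C v \<in> sets P" if "v \<in> V" for v
    using C[OF that] sets_filt_mono[of "Time (ennreal v)" Beyond] P(2) by auto
  have Ymeas: "Y (ennreal v) \<in> borel_measurable P" for v
    using Y by (intro filt_measurableI[OF P(2), of _ "Time (ennreal v)"]) (auto simp: nonneg_martingale_def)
  have split: "f \<omega> * indicator C \<omega> = (\<Sum>v\<in>V. f \<omega> * indicator (?C v) \<omega>)" for f :: "path \<Rightarrow> ennreal" and \<omega>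
  proof (cases "\<omega> \<in> C")
    case True
    have "(\<Sum>v\<in>V. f \<omega> * indicator (?C v) \<omega>) = (\<Sum>v\<in>V. if v = \<rho> \<omega> then f \<omega> else 0)"
      using True by (intro sum.cong) (auto simp: indicator_def)
    then show ?thesis using True V(1,3) by simp
  qed simp
  have "(\<integral>\<^sup>+\<omega>\<in>C. Y (ennreal (\<rho> \<omega>)) \<omega> \<partial>P) = (\<integral>\<^sup>+\<omega>. (\<Sum>v\<in>V. Y (ennreal v) \<omega> * indicator (?C v) \<omega>) \<partial>P)"
    unfolding split by (intro nn_integral_cong sum.cong) (auto simp: indicator_def)
  also have "\<dots> = (\<Sum>v\<in>V. \<integral>\<^sup>+\<omega>\<in>?C v. Y (ennreal v) \<omega> \<partial>P)"
    using Ysets Ymeas by (intro nn_integral_sum) simp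
  also have "\<dots> = (\<Sum>v\<in>V. \<integral>\<^sup>+\<omega>\<in>?C v. Y (ennreal t) \<omega> \<partial>P)"
    using V(2) C by (intro sum.cong refl nonneg_martingale_nn_integral[OF P Y, symmetric])
       (auto simp: ennreal_leI)
  also have "\<dots> = (\<integral>\<^sup>+\<omega>. (\<Sum>v\<in>V. Y (ennreal t) \<omega> * indicator (?C v) \<omega>) \<partial>P)"
    using Ysets Ymeas by (intro nn_integral_sum[symmetric]) simp
  also have "\<dots> = (\<integral>\<^sup>+\<omega>\<in>C. Y (ennreal t) \<omega> \<partial>P)" unfolding split ..
  finally show ?thesis .
qed

lemma grid_time_tendsto:
  fixes s t :: real
  assumes "0 \<le> s" "s \<le> t" "\<not> \<sigma> \<omega> \<le> Time (ennreal s)"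
  defines "G \<equiv> \<lambda>N. insert t ({s..t} \<inter> (\<lambda>n. real_of_rat (nat_to_rat_surj n)) ` {..N::nat})"
    and "m \<equiv> (case \<sigma> \<omega> of Time u \<Rightarrow> min u (ennreal t) | Beyond \<Rightarrow> ennreal t)"
  shows "(\<lambda>N. grid_time (G N) t \<sigma> \<omega>) \<longlonglongrightarrow> enn2real m" "ennreal (enn2real m) = m" "enn2real m \<le> t"
proof -
  have "m \<le> ennreal t" by (auto simp: m_def split: etime.splits)
  then show m: "ennreal (enn2real m) = m" "enn2real m \<le> t"
    using assms(1,2) ennreal_enn2real[OF le_less_trans, of m "ennreal t"] by (auto intro: enn2real_leI)
  have "s \<le> t" "0 \<le> t" using assms by auto
  have "ennreal s \<le> m" using assms(3) \<open>s \<le> t\<close>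
    by (auto simp: m_def ennreal_leI min_def split: etime.splits)
  then have sm: "s \<le> enn2real m" using m(1) by (metis enn2real_nonneg ennreal_le_iff)
  have G: "finite (G N)" "t \<in> G N" for N by (auto simp: G_def)
  show "(\<lambda>N. grid_time (G N) t \<sigma> \<omega>) \<longlonglongrightarrow> enn2real m"
  proof (rule order_tendstoI)
    fix x assume "x < enn2real m"
    moreover have "enn2real m \<le> grid_time (G N) t \<sigma> \<omega>" for N
    proof -
      have v: "grid_time (G N) t \<sigma> \<omega> \<in> G N" "\<sigma> \<omega> \<le> Time (ennreal (grid_time (G N) t \<sigma> \<omega>)) \<or> grid_time (G N) t \<sigma> \<omega> = t"
        using grid_time_mem[OF G(1)[of N] G(2)[of N], of \<sigma> \<omega>] by auto
      have "G N \<subseteq> {s..t}" using assms(2) by (auto simp: G_def)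
      then have "0 \<le> grid_time (G N) t \<sigma> \<omega>" using v(1) assms(1) by auto
      moreover have "m \<le> ennreal (grid_time (G N) t \<sigma> \<omega>)"
        using v(2) by (auto simp: m_def intro: min.coboundedI1 split: etime.splits)
      ultimately show ?thesis using enn2real_leI by blast
    qed
    ultimately show "eventually (\<lambda>N. x < grid_time (G N) t \<sigma> \<omega>) sequentially"
      by (intro always_eventually allI) (rule less_le_trans)
  next
    fix x assume x: "enn2real m < x"
    show "eventually (\<lambda>N. grid_time (G N) t \<sigma> \<omega> < x) sequentially"
    proof (cases "enn2real m = t")
      case True
      then have "grid_time (G N) t \<sigma> \<omega> < x" for N
        using grid_time_le[OF G(1)[of N] G(2)[of N], of \<sigma> \<omega> t] x by simp
      then show ?thesis by simp
    next
      case False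
      then have "enn2real m < min x t" using x m(2) by simp
      then obtain q where q: "q \<in> \<rat>" "enn2real m < q" "q < min x t"
        using Rats_dense_in_real by blast
      then obtain n where n: "q = real_of_rat (nat_to_rat_surj n)"
        using surj_nat_to_rat_surj by (metis Rats_cases surj_def)
      have "m < ennreal t" using m False by (metis enn2real_nonneg ennreal_less_iff order_less_le)
      then obtain u where u: "\<sigma> \<omega> = Time u" "m = u"
        by (cases "\<sigma> \<omega>") (auto simp: m_def min_def split: if_splits)
      have "m \<le> ennreal q" using m(1) q(2) by (metis ennreal_leI less_imp_le)
      then have "grid_time (G N) t \<sigma> \<omega> < x" if "n \<le> N" for N
        using grid_time_le[OF G(1)[of N], of q \<sigma> \<omega> t] q sm u n that by (auto simp: G_def)
      then show ?thesis unfolding eventually_sequentially by blast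
    qed
  qed
qed

text \<open>Optional stopping for a nonnegative martingale with continuous paths. Rounding the stopping
  time up to finer and finer grids gives integrals that all equal the integral of \<open>Y\<^sub>t\<close>. Fatou's
  lemma bounds the integral of the limit from above. For the bound from below the sampled values
  are truncated at a level \<open>K\<close>: a continuous path is bounded on \<open>{0..t}\<close>, so that the events on which
  no sampled value exceeds \<open>K\<close> exhaust \<open>A\<close> up to a null set as \<open>K\<close> grows. The value at the stopping time
  is an almost sure limit of measurable functions, and \<open>L\<close> is a measurable version of it.\<close>

lemma optional_stopping:
  fixes s t :: real and Y :: "ennreal \<Rightarrow> path \<Rightarrow> ennreal"
  assumes P: "prob_space P" "sets P = sets (filt Beyond)"
    and Y: "nonneg_martingale P Y"
    and cont: "AE \<omega> in P. (\<forall>r\<ge>0. Y (ennreal r) \<omega> \<noteq> \<infinity>) \<and> continuous_on {0..} (\<lambda>r. Y (ennreal r) \<omega>)"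
    and \<sigma>: "stopping_time filt \<sigma>"
    and st: "0 \<le> s" "s \<le> t"
    and A: "A \<in> sets (filt (Time (ennreal s)))" "\<And>\<omega>. \<omega> \<in> A \<Longrightarrow> \<not> \<sigma> \<omega> \<le> Time (ennreal s)"
  defines "m \<equiv> \<lambda>\<omega>. case \<sigma> \<omega> of Time u \<Rightarrow> min u (ennreal t) | Beyond \<Rightarrow> ennreal t"
  obtains L where "L \<in> borel_measurable P" "AE \<omega> in P. L \<omega> = Y (m \<omega>) \<omega> * indicator A \<omega>"
    "(\<integral>\<^sup>+\<omega>. L \<omega> \<partial>P) = (\<integral>\<^sup>+\<omega>\<in>A. Y (ennreal s) \<omega> \<partial>P)"
proof -
  interpret prob_space P by fact
  \<comment> \<open>The grids consist of \<open>t\<close> and of more and more rational points between \<open>s\<close> and \<open>t\<close>.\<close>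
  define G where "G = (\<lambda>N. insert t ({s..t} \<inter> (\<lambda>n. real_of_rat (nat_to_rat_surj n)) ` {..N::nat}))"
  define \<rho> where "\<rho> = (\<lambda>N. grid_time (G N) t \<sigma>)"
  define W where "W = (\<lambda>N \<omega>. Y (ennreal (\<rho> N \<omega>)) \<omega>)"
  have G: "finite (G N)" "t \<in> G N" "G N \<subseteq> {s..t}" for N using st by (auto simp: G_def)
  have G0: "G N \<subseteq> {0..t}" for N using G(3)[of N] st by auto
  have \<rho>G: "\<rho> N \<omega> \<in> G N" for N \<omega>
    using grid_time_mem[OF G(1,2), of N] unfolding \<rho>_def by blast
  have Yadapted: "Y (ennreal v) \<in> borel_measurable (filt (Time (ennreal v)))" for v
    using Y by (simp add: nonneg_martingale_def)
  have Ymeas [measurable]: "Y (ennreal v) \<in> borel_measurable P" for v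
    using filt_measurableI[OF P(2) Yadapted] .
  have \<rho>pred: "Measurable.pred (filt (Time (ennreal v))) (\<lambda>\<omega>. \<rho> N \<omega> = v)" if "v \<in> G N" for v N
    unfolding \<rho>_def using G(1,2) G0 \<sigma> that by (rule pred_grid_time)
  have Wmeas [measurable]: "W N \<in> borel_measurable P" for N
    unfolding W_def
  proof (rule measurable_compose_countable'[where I="G N"])
    show "\<rho> N \<in> measurable P (count_space (G N))"
    unfolding measurable_count_space_eq2[OF G(1)]
    proof (intro conjI ballI)
      fix v assume v: "v \<in> G N"
      have "{\<omega>\<in>space P. \<rho> N \<omega> = v} \<in> sets P"
        using filt_measurableI[OF P(2) \<rho>pred[OF v]] unfolding pred_def .
      also have "{\<omega>\<in>space P. \<rho> N \<omega> = v} = \<rho> N -` {v} \<inter> space P" by auto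
      finally show "\<rho> N -` {v} \<inter> space P \<in> sets P" .
    qed (use \<rho>G in auto)
  qed (use G(1) in \<open>auto intro: countable_finite\<close>)
  have Aat: "A \<in> sets (filt (Time (ennreal v)))" if "v \<in> G N" for v N
  proof -
    have "s \<le> v" using G(3)[of N] that by auto
    then show ?thesis
      using A(1) sets_filt_mono[of "Time (ennreal s)" "Time (ennreal v)"] ennreal_leI[of s v] by auto
  qed
  have [measurable]: "A \<in> sets P" using A(1) sets_filt_mono[of "Time (ennreal s)" Beyond] P(2) by auto
  have AC: "A \<subseteq> C_abs" using sets.sets_into_space[OF A(1)] by simp
  have sampled: "(\<integral>\<^sup>+\<omega>\<in>A. W N \<omega> \<partial>P) = (\<integral>\<^sup>+\<omega>\<in>A. Y (ennreal t) \<omega> \<partial>P)" for N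
    unfolding W_def
  proof (rule nn_integral_finite_sampling[OF P Y G(1) G0 \<rho>G])
    fix v assume v: "v \<in> G N"
    have "A \<inter> {\<omega>\<in>space (filt (Time (ennreal v))). \<rho> N \<omega> = v} \<in> sets (filt (Time (ennreal v)))"
      using Aat[OF v] \<rho>pred[OF v] by (auto simp: pred_def)
    also have "A \<inter> {\<omega>\<in>space (filt (Time (ennreal v))). \<rho> N \<omega> = v} = A \<inter> {\<omega>. \<rho> N \<omega> = v}" using AC by auto
    finally show "A \<inter> {\<omega>. \<rho> N \<omega> = v} \<in> sets (filt (Time (ennreal v)))" .
  qed
  have sampled_le: "(\<integral>\<^sup>+\<omega>\<in>A \<inter> {\<omega>. W N \<omega> \<le> K}. W N \<omega> \<partial>P) = (\<integral>\<^sup>+\<omega>\<in>A \<inter> {\<omega>. W N \<omega> \<le> K}. Y (ennreal t) \<omega> \<partial>P)" for N K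
    unfolding W_def
  proof (rule nn_integral_finite_sampling[OF P Y G(1) G0 \<rho>G])
    fix v assume v: "v \<in> G N"
    note [measurable] = \<rho>pred[OF v] Yadapted[of v] Aat[OF v]
    have "{\<omega>\<in>space (filt (Time (ennreal v))). \<omega> \<in> A \<and> \<rho> N \<omega> = v \<and> Y (ennreal v) \<omega> \<le> K} \<in> sets (filt (Time (ennreal v)))"
      by measurable
    also have "{\<omega>\<in>space (filt (Time (ennreal v))). \<omega> \<in> A \<and> \<rho> N \<omega> = v \<and> Y (ennreal v) \<omega> \<le> K} =
       A \<inter> {\<omega>. Y (ennreal (\<rho> N \<omega>)) \<omega> \<le> K} \<inter> {\<omega>. \<rho> N \<omega> = v}" using AC by auto
    finally show "A \<inter> {\<omega>. Y (ennreal (\<rho> N \<omega>)) \<omega> \<le> K} \<inter> {\<omega>. \<rho> N \<omega> = v} \<in> sets (filt (Time (ennreal v)))" .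
  qed
  define f where "f = (\<lambda>N \<omega>. W N \<omega> * indicator A \<omega>)"
  define L where "L = (\<lambda>\<omega>. liminf (\<lambda>N. f N \<omega>))"
  have [measurable]: "f N \<in> borel_measurable P" for N unfolding f_def by measurable
  have L [measurable]: "L \<in> borel_measurable P" unfolding L_def by measurable
  have lim: "AE \<omega> in P. (\<lambda>N. f N \<omega>) \<longlonglongrightarrow> Y (m \<omega>) \<omega> * indicator A \<omega>"
    using cont
  proof eventually_elim
    case (elim \<omega>)
    show ?case
    proof (cases "\<omega> \<in> A")
      case True
      have grid: "(\<lambda>N. \<rho> N \<omega>) \<longlonglongrightarrow> enn2real (m \<omega>)" "ennreal (enn2real (m \<omega>)) = m \<omega>"
        using grid_time_tendsto(1,2)[of s t \<sigma> \<omega>, OF st A(2)[OF True]] by (simp_all only: m_def \<rho>_def G_def)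
      have "(\<lambda>N. Y (ennreal (\<rho> N \<omega>)) \<omega>) \<longlonglongrightarrow> Y (ennreal (enn2real (m \<omega>))) \<omega>"
      proof (rule continuous_on_tendsto_compose[OF _ grid(1)])
        show "continuous_on {0..} (\<lambda>r. Y (ennreal r) \<omega>)" using elim by blast
        have "\<rho> N \<omega> \<in> {0..}" for N using \<rho>G[of N \<omega>] G0[of N] by auto
        then show "eventually (\<lambda>N. \<rho> N \<omega> \<in> {0..}) sequentially" by simp
      qed simp
      then show ?thesis using True grid(2) by (simp add: f_def W_def)
    qed (simp add: f_def)
  qed
  then have L_eq: "AE \<omega> in P. L \<omega> = Y (m \<omega>) \<omega> * indicator A \<omega>"
    by eventually_elim (simp add: L_def lim_imp_Liminf)
  have lim': "AE \<omega> in P. (\<lambda>N. f N \<omega>) \<longlonglongrightarrow> L \<omega>"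
    using lim L_eq by eventually_elim simp
  have "(\<integral>\<^sup>+\<omega>. L \<omega> \<partial>P) = (\<integral>\<^sup>+\<omega>\<in>A. Y (ennreal t) \<omega> \<partial>P)"
  proof (rule antisym)
    have "(\<integral>\<^sup>+\<omega>. L \<omega> \<partial>P) \<le> liminf (\<lambda>N. \<integral>\<^sup>+\<omega>. f N \<omega> \<partial>P)"
      unfolding L_def by (rule nn_integral_liminf) measurable
    also have "\<dots> = (\<integral>\<^sup>+\<omega>\<in>A. Y (ennreal t) \<omega> \<partial>P)"
      unfolding f_def sampled by (simp add: Liminf_const)
    finally show "(\<integral>\<^sup>+\<omega>. L \<omega> \<partial>P) \<le> (\<integral>\<^sup>+\<omega>\<in>A. Y (ennreal t) \<omega> \<partial>P)" .
  next
    define S where "S = (\<lambda>K::nat. {\<omega>\<in>space P. \<omega> \<in> A \<and> (\<forall>N. W N \<omega> \<le> of_nat K)})"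
    have [measurable]: "S K \<in> sets P" for K unfolding S_def by measurable
    have below: "(\<integral>\<^sup>+\<omega>\<in>S K. Y (ennreal t) \<omega> \<partial>P) \<le> (\<integral>\<^sup>+\<omega>. L \<omega> \<partial>P)" for K
    proof -
      have "(\<lambda>N. \<integral>\<^sup>+\<omega>. min (f N \<omega>) (of_nat K) \<partial>P) \<longlonglongrightarrow> (\<integral>\<^sup>+\<omega>. min (L \<omega>) (of_nat K) \<partial>P)"
      proof (rule nn_integral_dominated_convergence[where w="\<lambda>_. of_nat K"])
        show "AE \<omega> in P. (\<lambda>N. min (f N \<omega>) (of_nat K)) \<longlonglongrightarrow> min (L \<omega>) (of_nat K)"
          using lim' by eventually_elim (intro tendsto_min tendsto_const)
      qed (auto simp: emeasure_space_1 of_nat_less_top)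
      moreover have "(\<integral>\<^sup>+\<omega>\<in>S K. Y (ennreal t) \<omega> \<partial>P) \<le> (\<integral>\<^sup>+\<omega>. min (f N \<omega>) (of_nat K) \<partial>P)" for N
      proof -
        have "(\<integral>\<^sup>+\<omega>\<in>S K. Y (ennreal t) \<omega> \<partial>P) \<le> (\<integral>\<^sup>+\<omega>\<in>A \<inter> {\<omega>. W N \<omega> \<le> of_nat K}. Y (ennreal t) \<omega> \<partial>P)"
          by (intro nn_integral_mono) (auto simp: S_def indicator_def)
        also have "\<dots> = (\<integral>\<^sup>+\<omega>\<in>A \<inter> {\<omega>. W N \<omega> \<le> of_nat K}. W N \<omega> \<partial>P)" by (rule sampled_le[symmetric])
        also have "\<dots> \<le> (\<integral>\<^sup>+\<omega>. min (f N \<omega>) (of_nat K) \<partial>P)"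
          by (intro nn_integral_mono) (auto simp: f_def indicator_def)
        finally show ?thesis .
      qed
      ultimately have "(\<integral>\<^sup>+\<omega>\<in>S K. Y (ennreal t) \<omega> \<partial>P) \<le> (\<integral>\<^sup>+\<omega>. min (L \<omega>) (of_nat K) \<partial>P)"
        by (intro LIMSEQ_le_const) auto
      also have "\<dots> \<le> (\<integral>\<^sup>+\<omega>. L \<omega> \<partial>P)" by (intro nn_integral_mono) simp
      finally show ?thesis .
    qed
    have "(\<integral>\<^sup>+\<omega>\<in>A. Y (ennreal t) \<omega> \<partial>P) = (\<integral>\<^sup>+\<omega>. (SUP K. Y (ennreal t) \<omega> * indicator (S K) \<omega>) \<partial>P)"
    proof (rule nn_integral_cong_AE)
      show "AE \<omega> in P. Y (ennreal t) \<omega> * indicator A \<omega> = (SUP K. Y (ennreal t) \<omega> * indicator (S K) \<omega>)"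
        using cont AE_space
      proof eventually_elim
        case (elim \<omega>)
        have "continuous_on {0..t} (\<lambda>r. Y (ennreal r) \<omega>)"
          by (rule continuous_on_subset[of "{0..}"]) (use elim in auto)
        then obtain u where u: "u \<in> {0..t}" "\<And>v. v \<in> {0..t} \<Longrightarrow> Y (ennreal v) \<omega> \<le> Y (ennreal u) \<omega>"
          using continuous_attains_sup[of "{0..t}" "\<lambda>r. Y (ennreal r) \<omega>"] st by auto
        then have "Y (ennreal u) \<omega> < \<infinity>" using elim by (auto simp: less_top)
        then obtain K :: nat where "Y (ennreal u) \<omega> < of_nat K"
          using ennreal_Ex_less_of_nat by auto
        then have "W N \<omega> \<le> of_nat K" for N
          using u(2)[of "\<rho> N \<omega>"] \<rho>G[of N \<omega>] G0[of N] unfolding W_def by force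
        then have K: "\<omega> \<in> S K" if "\<omega> \<in> A" using that elim by (simp add: S_def)
        show ?case
        proof (rule antisym)
          show "Y (ennreal t) \<omega> * indicator A \<omega> \<le> (SUP K. Y (ennreal t) \<omega> * indicator (S K) \<omega>)"
            using K by (intro SUP_upper2[of K]) (auto simp: indicator_def)
          show "(SUP K. Y (ennreal t) \<omega> * indicator (S K) \<omega>) \<le> Y (ennreal t) \<omega> * indicator A \<omega>"
            by (intro SUP_least) (auto simp: S_def indicator_def)
        qed
      qed
    qed
    also have "\<dots> = (SUP K. \<integral>\<^sup>+\<omega>\<in>S K. Y (ennreal t) \<omega> \<partial>P)"
    proof (rule nn_integral_monotone_convergence_SUP)
      show "incseq (\<lambda>K \<omega>. Y (ennreal t) \<omega> * indicator (S K) \<omega>)"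
      proof (intro monoI le_funI)
        fix K K' :: nat and \<omega> assume "K \<le> K'"
        then have "(of_nat K :: ennreal) \<le> of_nat K'" by (rule of_nat_mono)
        then have "S K \<subseteq> S K'" unfolding S_def using order_trans by blast
        then show "Y (ennreal t) \<omega> * indicator (S K) \<omega> \<le> Y (ennreal t) \<omega> * indicator (S K') \<omega>"
          by (auto simp: indicator_def)
      qed
    qed simp
    also have "\<dots> \<le> (\<integral>\<^sup>+\<omega>. L \<omega> \<partial>P)" by (intro SUP_least below)
    finally show "(\<integral>\<^sup>+\<omega>\<in>A. Y (ennreal t) \<omega> \<partial>P) \<le> (\<integral>\<^sup>+\<omega>. L \<omega> \<partial>P)" .
  qed
  also have "\<dots> = (\<integral>\<^sup>+\<omega>\<in>A. Y (ennreal s) \<omega> \<partial>P)"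
    using st A(1) by (intro nonneg_martingale_nn_integral[OF P Y]) (auto simp: ennreal_leI)
  finally show ?thesis by (rule that[OF L L_eq])
qed

section \<open>The coordinate process stopped at a level\<close>

lemma space_P: "sets P = sets (filt Beyond) \<Longrightarrow> space P = C_abs"
  using sets_eq_imp_space_eq[of P "filt Beyond"] by simp

lemma AE_C_abs: "sets P = sets (filt Beyond) \<Longrightarrow> AE \<omega> in P. \<omega> \<in> C_abs"
  using AE_space[of P] by (simp add: space_P)

text \<open>At a natural time \<open>k\<close> the process agrees with one of the stopped martingales, which have finite
  expectation; absorption in \<open>\<infinity>\<close> passes from the natural times to all times.\<close>

lemma local_martingale_AE_finite:
  assumes P: "sets P = sets (filt Beyond)" "coord_local_martingale P"
  shows "AE \<omega> in P. \<forall>r\<ge>0. \<omega> r \<noteq> \<infinity>"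
proof -
  obtain \<tau> :: "nat \<Rightarrow> path \<Rightarrow> etime" where \<tau>: "\<And>n. nonneg_martingale P (stopped (\<tau> n))"
    and exhaust: "AE \<omega> in P. incseq (\<lambda>n. \<tau> n \<omega>) \<and> (\<forall>t<\<infinity>. \<exists>n. Time t < \<tau> n \<omega>)"
    using P(2) unfolding coord_local_martingale_def by blast
  have "AE \<omega> in P. stopped (\<tau> n) (ennreal (real k)) \<omega> \<noteq> \<infinity>" for n k :: nat
  proof (rule nn_integral_PInf_AE)
    have "stopped (\<tau> n) (ennreal (real k)) \<in> borel_measurable (filt (Time (ennreal (real k))))"
      "(\<integral>\<^sup>+\<omega>. stopped (\<tau> n) (ennreal (real k)) \<omega> \<partial>P) < \<infinity>"
      using \<tau>[of n] by (auto simp: nonneg_martingale_def)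
    then show "stopped (\<tau> n) (ennreal (real k)) \<in> borel_measurable P"
      "(\<integral>\<^sup>+\<omega>. stopped (\<tau> n) (ennreal (real k)) \<omega> \<partial>P) \<noteq> \<infinity>"
      using filt_measurableI[OF P(1)] by auto
  qed
  then have "AE \<omega> in P. \<forall>n k. stopped (\<tau> n) (ennreal (real k)) \<omega> \<noteq> \<infinity>"
    by (simp only: AE_all_countable) simp
  then show ?thesis
    using exhaust AE_C_abs[OF P(1)]
  proof eventually_elim
    case (elim \<omega>)
    show ?case
    proof (intro allI impI)
      fix r :: real assume r: "0 \<le> r"
      obtain k :: nat where k: "r \<le> real k" using real_arch_simple by blast
      have "ennreal (real k) < \<infinity>" by simp
      then obtain n where n: "Time (ennreal (real k)) < \<tau> n \<omega>" using elim by blast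
      have "stopped (\<tau> n) (ennreal (real k)) \<omega> = \<omega> (real k)"
        using n by (auto simp: stopped_coord min_absorb2 split: etime.splits)
      then have "\<omega> (real k) \<noteq> \<infinity>" using elim by metis
      then show "\<omega> r \<noteq> \<infinity>" using path_finite_before[OF _ r k] elim by blast
    qed
  qed
qed

lemma stopped_continuous:
  assumes "\<omega> \<in> C_abs" "\<And>r. 0 \<le> r \<Longrightarrow> \<omega> r \<noteq> \<infinity>"
  shows "\<forall>r\<ge>0. stopped \<tau> (ennreal r) \<omega> \<noteq> \<infinity>" "continuous_on {0..} (\<lambda>r. stopped \<tau> (ennreal r) \<omega>)"
proof -
  have "{t. 0 \<le> t \<and> Time (ennreal t) < hit \<infinity> \<omega>} = {0..}"
    using less_hit_infinity_iff[OF assms(1)] assms(2) by auto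
  then have cont: "continuous_on {0..} \<omega>"
    using assms(1) unfolding C_abs_def by auto
  have "(\<exists>u\<ge>0. \<forall>r\<ge>0. stopped \<tau> (ennreal r) \<omega> = \<omega> (min u r)) \<or> (\<forall>r\<ge>0. stopped \<tau> (ennreal r) \<omega> = \<omega> r)"
  proof (cases "\<tau> \<omega>")
    case (Time s)
    show ?thesis
    proof (cases s rule: ennreal_times)
      case (2 u)
      have "stopped \<tau> (ennreal r) \<omega> = \<omega> (min u r)" if "0 \<le> r" for r
        using Time 2 that by (simp add: stopped_coord min_def)
      then show ?thesis using 2 by blast
    qed (simp add: stopped_coord Time)
  qed (simp add: stopped_coord)
  then show "\<forall>r\<ge>0. stopped \<tau> (ennreal r) \<omega> \<noteq> \<infinity>" "continuous_on {0..} (\<lambda>r. stopped \<tau> (ennreal r) \<omega>)"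
  proof (atomize (full), elim disjE exE conjE)
    fix u :: real assume u: "0 \<le> u" and eq: "\<forall>r\<ge>0. stopped \<tau> (ennreal r) \<omega> = \<omega> (min u r)"
    have "continuous_on {0..} (\<lambda>r. \<omega> (min u r))"
      by (rule continuous_on_compose2[OF cont]) (use u in \<open>auto intro!: continuous_intros\<close>)
    then show "(\<forall>r\<ge>0. stopped \<tau> (ennreal r) \<omega> \<noteq> \<infinity>) \<and> continuous_on {0..} (\<lambda>r. stopped \<tau> (ennreal r) \<omega>)"
      using eq u assms(2) by (simp cong: continuous_on_cong_simp)
  next
    assume eq: "\<forall>r\<ge>0. stopped \<tau> (ennreal r) \<omega> = \<omega> r"
    then show "(\<forall>r\<ge>0. stopped \<tau> (ennreal r) \<omega> \<noteq> \<infinity>) \<and> continuous_on {0..} (\<lambda>r. stopped \<tau> (ennreal r) \<omega>)"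
      using cont assms(2) by (simp cong: continuous_on_cong_simp)
  qed
qed

lemma coord_le_before_hit:
  assumes "\<omega> \<in> C_abs" "\<And>r. 0 \<le> r \<Longrightarrow> \<omega> r \<noteq> \<infinity>" "\<omega> 0 \<le> a" "u < \<infinity>" "Time u \<le> hit a \<omega>"
  shows "coord u \<omega> \<le> a"
proof -
  obtain r where "0 \<le> r" "u = ennreal r" using assms(4) by (cases u) auto
  then have "coord u \<omega> \<noteq> \<infinity>" using assms(2) by simp
  moreover have "stopped (hit a) u \<omega> = coord u \<omega>"
    using assms(5) by (auto simp: stopped_coord min_absorb2 split: etime.splits)
  ultimately show ?thesis using stopped_hit_le[OF assms(1,3,4)] by simp
qed

text \<open>Localisation: with \<open>\<tau>\<^sub>n\<close> a localising sequence, optional stopping applies to the martingales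
  \<open>X\<close> stopped at \<open>\<tau>\<^sub>n\<close>, and up to the hitting time all of them are bounded by the level \<open>a\<close>, so that
  dominated convergence removes \<open>\<tau>\<^sub>n\<close>. Only the event that \<open>a\<close> has not been hit by time \<open>s\<close> matters,
  because afterwards the stopped process is constant.\<close>

lemma ui_martingale_stopped_hit:
  assumes P: "prob_space P" "sets P = sets (filt Beyond)"
    and loc: "coord_local_martingale P"
    and start: "AE \<omega> in P. \<omega> 0 \<le> ennreal a"
  shows "ui_martingale P (stopped (hit (ennreal a)))"
  unfolding ui_martingale_def
proof (rule conjI)
  interpret prob_space P by fact
  let ?T = "hit (ennreal a)"
  have fin: "AE \<omega> in P. \<forall>r\<ge>0. \<omega> r \<noteq> \<infinity>" by (rule local_martingale_AE_finite[OF P(2) loc])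
  have bound: "AE \<omega> in P. stopped ?T t \<omega> \<le> ennreal a" if t: "t < \<infinity>" for t
    using fin start AE_C_abs[OF P(2)]
  proof eventually_elim
    case (elim \<omega>)
    obtain r where "0 \<le> r" "t = ennreal r" using t by (cases t) auto
    then show ?case using elim by (intro stopped_hit_le) auto
  qed
  then show "uniformly_integrable P (stopped ?T)" by (rule bounded_uniformly_integrable)
  have meas: "stopped ?T t \<in> borel_measurable (filt (Time t))" if "t < \<infinity>" for t
    using that by (intro stopped_hit_measurable) auto
  have measP [measurable]: "stopped ?T t \<in> borel_measurable P" if "t < \<infinity>" for t
    using filt_measurableI[OF P(2) meas[OF that]] .
  obtain \<tau> :: "nat \<Rightarrow> path \<Rightarrow> etime" where \<tau>: "\<And>n. nonneg_martingale P (stopped (\<tau> n))"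
    and exhaust: "AE \<omega> in P. incseq (\<lambda>n. \<tau> n \<omega>) \<and> (\<forall>t<\<infinity>. \<exists>n. Time t < \<tau> n \<omega>)"
    using loc unfolding coord_local_martingale_def by blast
  show "nonneg_martingale P (stopped ?T)"
  proof (rule nonneg_martingaleI[OF P meas])
    fix t :: ennreal assume t: "t < \<infinity>"
    have "(\<integral>\<^sup>+\<omega>. stopped ?T t \<omega> \<partial>P) \<le> (\<integral>\<^sup>+\<omega>. ennreal a \<partial>P)"
      using bound[OF t] by (rule nn_integral_mono_AE)
    then show "(\<integral>\<^sup>+\<omega>. stopped ?T t \<omega> \<partial>P) < \<infinity>" by (simp add: emeasure_space_1 le_less_trans)
  next
    fix s t :: ennreal and A assume "s \<le> t" and t: "t < \<infinity>" and A: "A \<in> sets (filt (Time s))"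
    then have s: "s < \<infinity>" by (simp add: le_less_trans)
    obtain s' where s': "0 \<le> s'" "s = ennreal s'" using s by (cases s) auto
    obtain t' where t': "0 \<le> t'" "t = ennreal t'" using t by (cases t) auto
    have "s' \<le> t'" using \<open>s \<le> t\<close> s' t' by simp
    define A1 A2 where "A1 = A \<inter> {\<omega>\<in>C_abs. ?T \<omega> \<le> Time s}" and "A2 = A \<inter> {\<omega>\<in>C_abs. \<not> ?T \<omega> \<le> Time s}"
    have hit_s: "{\<omega>\<in>C_abs. ?T \<omega> \<le> Time s} \<in> sets (filt (Time s))"
      using pred_hit_le[of "ennreal a" s "Time s"] by (simp add: pred_def)
    have "{\<omega>\<in>C_abs. \<not> ?T \<omega> \<le> Time s} = space (filt (Time s)) - {\<omega>\<in>C_abs. ?T \<omega> \<le> Time s}" by auto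
    then have "{\<omega>\<in>C_abs. \<not> ?T \<omega> \<le> Time s} \<in> sets (filt (Time s))"
      using sets.compl_sets[OF hit_s] by (simp only:)
    then have A12: "A1 \<in> sets (filt (Time s))" "A2 \<in> sets (filt (Time s))"
      unfolding A1_def A2_def using A hit_s by (simp_all only: sets.Int)
    have "sets (filt (Time s)) \<subseteq> sets P" unfolding P(2) by (rule sets_filt_mono) simp
    then have [measurable]: "A1 \<in> sets P" "A2 \<in> sets P" using A12 by blast+
    have A2: "\<omega> \<in> C_abs" "Time s < ?T \<omega>" if "\<omega> \<in> A2" for \<omega> using that by (auto simp: A2_def)
    define m where "m = (\<lambda>\<omega>. case ?T \<omega> of Time u \<Rightarrow> min u t | Beyond \<Rightarrow> t)"
    have m: "m \<omega> \<le> t" "Time (m \<omega>) \<le> ?T \<omega>" "stopped ?T t \<omega> = coord (m \<omega>) \<omega>" for \<omega>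
      by (auto simp: m_def stopped_coord split: etime.splits)
    have bound_coord: "AE \<omega> in P. \<forall>u<\<infinity>. Time u \<le> ?T \<omega> \<longrightarrow> coord u \<omega> \<le> ennreal a"
      using fin start AE_C_abs[OF P(2)] by eventually_elim (blast intro: coord_le_before_hit)
    have bound_n: "AE \<omega> in P. \<forall>n u. u < \<infinity> \<longrightarrow> Time u \<le> ?T \<omega> \<longrightarrow> stopped (\<tau> n) u \<omega> \<le> ennreal a"
      using bound_coord
    proof eventually_elim
      case (elim \<omega>)
      show ?case
      proof (intro allI impI)
        fix n u assume u: "u < (\<infinity>::ennreal)" "Time u \<le> ?T \<omega>"
        obtain v where v: "stopped (\<tau> n) u \<omega> = coord v \<omega>" "v \<le> u"
          by (cases "\<tau> n \<omega>") (auto simp: stopped_coord)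
        then have "v < \<infinity>" "Time v \<le> ?T \<omega>" using u by (auto intro: order_trans[of _ "Time u"])
        then show "stopped (\<tau> n) u \<omega> \<le> ennreal a" using elim v by simp
      qed
    qed
    have exhaust_t: "AE \<omega> in P. eventually (\<lambda>n. \<forall>u\<le>t. stopped (\<tau> n) u \<omega> = coord u \<omega>) sequentially"
      using exhaust
    proof eventually_elim
      case (elim \<omega>)
      then obtain n where n: "Time t < \<tau> n \<omega>" using t by blast
      have "stopped (\<tau> k) u \<omega> = coord u \<omega>" if "n \<le> k" "u \<le> t" for k u
      proof -
        have "\<tau> n \<omega> \<le> \<tau> k \<omega>" using elim \<open>n \<le> k\<close> by (auto simp: incseq_def)
        then have "Time t < \<tau> k \<omega>" using n by simp
        then show ?thesis using \<open>u \<le> t\<close> by (auto simp: stopped_coord min_absorb2 split: etime.splits)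
      qed
      then show ?case unfolding eventually_sequentially by blast
    qed
    have "\<exists>L. L \<in> borel_measurable P \<and> (AE \<omega> in P. L \<omega> = stopped (\<tau> n) (m \<omega>) \<omega> * indicator A2 \<omega>) \<and>
        (\<integral>\<^sup>+\<omega>. L \<omega> \<partial>P) = (\<integral>\<^sup>+\<omega>\<in>A2. stopped (\<tau> n) s \<omega> \<partial>P)" for n
    proof -
      have cont: "AE \<omega> in P. (\<forall>r\<ge>0. stopped (\<tau> n) (ennreal r) \<omega> \<noteq> \<infinity>) \<and>
          continuous_on {0..} (\<lambda>r. stopped (\<tau> n) (ennreal r) \<omega>)"
        using fin AE_C_abs[OF P(2)] by eventually_elim (intro conjI stopped_continuous; blast)
      have "A2 \<in> sets (filt (Time (ennreal s')))" using A12(2) s' by simp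
      moreover have "\<And>\<omega>. \<omega> \<in> A2 \<Longrightarrow> \<not> ?T \<omega> \<le> Time (ennreal s')" using A2(2) s' by (auto simp: not_le)
      moreover have "stopping_time filt ?T" by (rule stopping_time_hit) simp
      ultimately obtain L where "L \<in> borel_measurable P"
        "AE \<omega> in P. L \<omega> = stopped (\<tau> n) (case ?T \<omega> of Time u \<Rightarrow> min u (ennreal t') | Beyond \<Rightarrow> ennreal t') \<omega> * indicator A2 \<omega>"
        "(\<integral>\<^sup>+\<omega>. L \<omega> \<partial>P) = (\<integral>\<^sup>+\<omega>\<in>A2. stopped (\<tau> n) (ennreal s') \<omega> \<partial>P)"
        using optional_stopping[OF P \<tau>[of n] cont _ s'(1) \<open>s' \<le> t'\<close>, of ?T A2] by blast
      then show ?thesis unfolding m_def s'(2) t'(2) by blast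
    qed
    then have "\<exists>L. \<forall>n. L n \<in> borel_measurable P \<and>
        (AE \<omega> in P. L n \<omega> = stopped (\<tau> n) (m \<omega>) \<omega> * indicator A2 \<omega>) \<and>
        (\<integral>\<^sup>+\<omega>. L n \<omega> \<partial>P) = (\<integral>\<^sup>+\<omega>\<in>A2. stopped (\<tau> n) s \<omega> \<partial>P)"
      by (intro choice allI)
    then obtain L where L: "\<And>n. L n \<in> borel_measurable P"
      "\<And>n. AE \<omega> in P. L n \<omega> = stopped (\<tau> n) (m \<omega>) \<omega> * indicator A2 \<omega>"
      "\<And>n. (\<integral>\<^sup>+\<omega>. L n \<omega> \<partial>P) = (\<integral>\<^sup>+\<omega>\<in>A2. stopped (\<tau> n) s \<omega> \<partial>P)"
      by blast
    have L_AE: "AE \<omega> in P. \<forall>n. L n \<omega> = stopped (\<tau> n) (m \<omega>) \<omega> * indicator A2 \<omega>"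
      unfolding AE_all_countable using L(2) by blast
    have lim_t: "(\<lambda>n. \<integral>\<^sup>+\<omega>. L n \<omega> \<partial>P) \<longlonglongrightarrow> (\<integral>\<^sup>+\<omega>\<in>A2. stopped ?T t \<omega> \<partial>P)"
    proof (rule nn_integral_dominated_convergence[where w="\<lambda>_. ennreal a"])
      show "AE \<omega> in P. L n \<omega> \<le> ennreal a" for n
        using L(2)[of n] bound_n
      proof eventually_elim
        case (elim \<omega>)
        have "m \<omega> < \<infinity>" using m(1) t by (rule le_less_trans)
        then show ?case using elim m(2)[of \<omega>] by (auto simp: indicator_def)
      qed
      show "AE \<omega> in P. (\<lambda>n. L n \<omega>) \<longlonglongrightarrow> stopped ?T t \<omega> * indicator A2 \<omega>"
        using L_AE exhaust_t
      proof eventually_elim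
        case (elim \<omega>)
        show ?case
        proof (rule tendsto_eventually)
          show "eventually (\<lambda>n. L n \<omega> = stopped ?T t \<omega> * indicator A2 \<omega>) sequentially"
            using elim(2) by eventually_elim (simp add: elim(1) m)
        qed
      qed
    qed (use L(1) t in \<open>auto simp: emeasure_space_1\<close>)
    have lim_s: "(\<lambda>n. \<integral>\<^sup>+\<omega>\<in>A2. stopped (\<tau> n) s \<omega> \<partial>P) \<longlonglongrightarrow> (\<integral>\<^sup>+\<omega>\<in>A2. stopped ?T s \<omega> \<partial>P)"
    proof (rule nn_integral_dominated_convergence[where w="\<lambda>_. ennreal a"])
      show "(\<lambda>\<omega>. stopped (\<tau> n) s \<omega> * indicator A2 \<omega>) \<in> borel_measurable P" for n
      proof -
        have "stopped (\<tau> n) s \<in> borel_measurable (filt (Time s))"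
          using \<tau>[of n] s by (simp add: nonneg_martingale_def)
        then have [measurable]: "stopped (\<tau> n) s \<in> borel_measurable P" by (rule filt_measurableI[OF P(2)])
        show ?thesis by measurable
      qed
      show "AE \<omega> in P. stopped (\<tau> n) s \<omega> * indicator A2 \<omega> \<le> ennreal a" for n
        using bound_n
      proof eventually_elim
        case (elim \<omega>)
        then show ?case using A2(2)[of \<omega>] s by (auto simp: indicator_def)
      qed
      show "AE \<omega> in P. (\<lambda>n. stopped (\<tau> n) s \<omega> * indicator A2 \<omega>) \<longlonglongrightarrow> stopped ?T s \<omega> * indicator A2 \<omega>"
        using exhaust_t
      proof eventually_elim
        case (elim \<omega>)
        have "stopped ?T s \<omega> = coord s \<omega>" if "\<omega> \<in> A2"
          using A2[OF that] by (auto simp: stopped_hit dest: leD)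
        then show ?case using elim \<open>s \<le> t\<close>
          by (intro tendsto_eventually) (auto elim!: eventually_mono simp: indicator_def)
      qed
    qed (use s in \<open>auto simp: emeasure_space_1\<close>)
    have eq2: "(\<integral>\<^sup>+\<omega>\<in>A2. stopped ?T t \<omega> \<partial>P) = (\<integral>\<^sup>+\<omega>\<in>A2. stopped ?T s \<omega> \<partial>P)"
      using LIMSEQ_unique[OF lim_t] lim_s L(3) by simp
    have eq1: "(\<integral>\<^sup>+\<omega>\<in>A1. stopped ?T t \<omega> \<partial>P) = (\<integral>\<^sup>+\<omega>\<in>A1. stopped ?T s \<omega> \<partial>P)"
    proof (rule nn_integral_cong)
      fix \<omega>
      have "?T \<omega> \<le> Time s \<Longrightarrow> ?T \<omega> \<le> Time t" using \<open>s \<le> t\<close> by (auto intro: order_trans[of _ "Time s"])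
      then show "stopped ?T t \<omega> * indicator A1 \<omega> = stopped ?T s \<omega> * indicator A1 \<omega>"
        by (auto simp: A1_def indicator_def stopped_hit)
    qed
    have A_eq: "A = A1 \<union> A2" using sets.sets_into_space[OF A] by (auto simp: A1_def A2_def)
    have "A1 \<inter> A2 = {}" by (auto simp: A1_def A2_def)
    then show "(\<integral>\<^sup>+\<omega>\<in>A. stopped ?T t \<omega> \<partial>P) = (\<integral>\<^sup>+\<omega>\<in>A. stopped ?T s \<omega> \<partial>P)"
      using eq1 eq2 s t unfolding A_eq by (simp add: nn_integral_disjoint_pair)
  qed
qed

section \<open>Measures are determined before the hitting times of high levels\<close>

lemma space_filt_at [simp]: "space (filt_at \<tau>) = C_abs"
proof -
  have "{A \<in> sets (filt Beyond). \<forall>t<\<infinity>. A \<inter> {\<omega>. \<tau> \<omega> \<le> Time t} \<in> sets (filt (Time t))} \<subseteq> Pow C_abs"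
    using sets.space_closed[of "filt Beyond"] by auto
  then show ?thesis unfolding filt_at_def by (rule space_measure_of)
qed

definition cylinder :: "(real \<times> ennreal) set \<Rightarrow> path set" where
  "cylinder I = {\<omega> \<in> C_abs. \<forall>(t, c)\<in>I. c < \<omega> t}"

lemma sets_filt_Beyond_cylinder:
  "sets (filt Beyond) = sigma_sets C_abs (cylinder ` {I. finite I \<and> I \<subseteq> {0..} \<times> UNIV})"
  (is "_ = sigma_sets _ ?E")
proof
  have E: "?E \<subseteq> Pow C_abs" by (auto simp: cylinder_def)
  define N where "N = sigma C_abs ?E"
  have N: "sets N = sigma_sets C_abs ?E" "space N = C_abs"
    unfolding N_def using E by (simp_all add: space_measure_of)
  have coord: "coord s \<in> borel_measurable N" if s: "s < \<infinity>" for s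
  proof (rule borel_measurableI_greater)
    fix c
    obtain r where r: "0 \<le> r" "s = ennreal r" using s by (cases s) auto
    have "{\<omega> \<in> space N. c < coord s \<omega>} = cylinder {(r, c)}"
      using r by (auto simp: N cylinder_def)
    also have "\<dots> \<in> sets N" unfolding N using r by (intro sigma_sets.Basic) auto
    finally show "{\<omega> \<in> space N. c < coord s \<omega>} \<in> sets N" .
  qed
  have "{\<omega> \<in> C_abs. coord s \<omega> \<in> B} \<in> sets N" if "s < \<infinity>" "B \<in> sets borel" for s B
    using measurable_sets[OF coord[OF that(1)] that(2)] by (simp add: N vimage_def Int_def conj_commute)
  then have "{{\<omega> \<in> C_abs. coord s \<omega> \<in> B} | s B. s < \<infinity> \<and> Time s \<le> Beyond \<and> B \<in> sets borel} \<subseteq> sets N"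
    by blast
  from sets.sigma_sets_subset[OF this] show "sets (filt Beyond) \<subseteq> sigma_sets C_abs ?E"
    unfolding sets_filt N .
  have "cylinder I \<in> sets (filt Beyond)" if "finite I" "I \<subseteq> {0..} \<times> UNIV" for I
  proof -
    have "{\<omega>\<in>space (filt Beyond). \<forall>p\<in>I. snd p < \<omega> (fst p)} \<in> sets (filt Beyond)"
    proof (rule sets.sets_Collect_finite_All[OF _ that(1)])
      fix p assume "p \<in> I"
      then have [measurable]: "(\<lambda>\<omega>. \<omega> (fst p)) \<in> borel_measurable (filt Beyond)"
        using that(2) by (intro path_measurable) auto
      show "{\<omega>\<in>space (filt Beyond). snd p < \<omega> (fst p)} \<in> sets (filt Beyond)" by measurable
    qed
    also have "{\<omega>\<in>space (filt Beyond). \<forall>p\<in>I. snd p < \<omega> (fst p)} = cylinder I"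
      by (auto simp: cylinder_def split_beta)
    finally show ?thesis .
  qed
  then show "sigma_sets C_abs ?E \<subseteq> sets (filt Beyond)"
    using sets.sigma_sets_subset[of ?E "filt Beyond"] by auto
qed

text \<open>The events known at the hitting times \<open>T\<^sub>n\<close> are not increasing in \<open>n\<close>, since a path that
  starts above \<open>n\<close> may hit larger levels first. Cylinder sets avoid this: the cylinder of the path
  stopped at \<open>T\<^sub>n\<close> is known at \<open>T\<^sub>n\<close>, and its indicator converges to that of the cylinder.\<close>

lemma measure_eqI_before_hits:
  assumes Q: "prob_space Q1" "sets Q1 = sets (filt Beyond)" "prob_space Q2" "sets Q2 = sets (filt Beyond)"
    and eq: "\<And>n A. 1 < n \<Longrightarrow> A \<in> sets (filt_at (hit (of_nat n))) \<Longrightarrow> emeasure Q1 A = emeasure Q2 A"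
  shows "Q1 = Q2"
proof (rule measure_eqI_generator_eq)
  let ?\<I> = "{I. finite I \<and> I \<subseteq> {0..} \<times> (UNIV :: ennreal set)}"
  show "Int_stable (cylinder ` ?\<I>)"
  proof (rule Int_stableI)
    fix X Y assume "X \<in> cylinder ` ?\<I>" "Y \<in> cylinder ` ?\<I>"
    then obtain I J where IJ: "X = cylinder I" "Y = cylinder J" "I \<in> ?\<I>" "J \<in> ?\<I>" by blast
    have "X \<inter> Y = cylinder (I \<union> J)" unfolding IJ by (auto simp: cylinder_def)
    then show "X \<inter> Y \<in> cylinder ` ?\<I>" using IJ by blast
  qed
  show "cylinder ` ?\<I> \<subseteq> Pow C_abs" by (auto simp: cylinder_def)
  show "sets Q1 = sigma_sets C_abs (cylinder ` ?\<I>)" "sets Q2 = sigma_sets C_abs (cylinder ` ?\<I>)"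
    using Q sets_filt_Beyond_cylinder by auto
  show "range (\<lambda>_::nat. cylinder {}) \<subseteq> cylinder ` ?\<I>" "(\<Union>i::nat. cylinder {}) = C_abs"
    by (auto simp: cylinder_def)
  show "emeasure Q1 (cylinder {}) \<noteq> \<infinity>"
    using prob_space.emeasure_le_1[OF Q(1), of "cylinder {}"] by (auto simp: top_unique)
  fix X assume "X \<in> cylinder ` ?\<I>"
  then obtain I where I: "X = cylinder I" "finite I" "I \<subseteq> {0..} \<times> UNIV" by auto
  define A where "A = (\<lambda>n::nat. {\<omega>\<in>C_abs. \<forall>p\<in>I. snd p < stopped (hit (of_nat n)) (ennreal (fst p)) \<omega>})"
  have A: "A n \<in> sets (filt_at (hit (of_nat n)))" for n
  proof -
    have "{\<omega>\<in>space (filt_at (hit (of_nat n))). \<forall>p\<in>I. snd p < stopped (hit (of_nat n)) (ennreal (fst p)) \<omega>}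
        \<in> sets (filt_at (hit (of_nat n)))"
      using stopped_hit_filt_at[of "of_nat n"] by (intro sets.sets_Collect_finite_All[OF _ I(2)]) auto
    then show ?thesis by (simp add: A_def)
  qed
  have ind: "(\<lambda>n. indicator (A n) \<omega> :: ennreal) \<longlonglongrightarrow> indicator X \<omega>" if "\<omega> \<in> C_abs" for \<omega>
  proof (rule tendsto_eventually)
    have "eventually (\<lambda>n. \<forall>p\<in>I. snd p < stopped (hit (of_nat n)) (ennreal (fst p)) \<omega> \<longleftrightarrow> snd p < \<omega> (fst p)) sequentially"
      using that I(3) by (intro eventually_ball_finite[OF I(2)] ballI eventually_less_stopped_iff) auto
    then show "eventually (\<lambda>n. (indicator (A n) \<omega> :: ennreal) = indicator X \<omega>) sequentially"
      by eventually_elim (auto simp: A_def I(1) cylinder_def indicator_def split_beta)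
  qed
  have lim: "(\<lambda>n. emeasure Q (A n)) \<longlonglongrightarrow> emeasure Q X"
    if Q: "prob_space Q" "sets Q = sets (filt Beyond)" for Q
  proof -
    interpret prob_space Q by fact
    have [measurable]: "A n \<in> sets Q" "X \<in> sets Q" for n
      using sets_filt_at_subset[OF A[of n]] Q(2) I sets_filt_Beyond_cylinder by auto
    have "(\<lambda>n. \<integral>\<^sup>+\<omega>. indicator (A n) \<omega> \<partial>Q) \<longlonglongrightarrow> (\<integral>\<^sup>+\<omega>. indicator X \<omega> \<partial>Q)"
    proof (rule nn_integral_dominated_convergence[where w="\<lambda>_. 1"])
      show "AE \<omega> in Q. (\<lambda>n. indicator (A n) \<omega> :: ennreal) \<longlonglongrightarrow> indicator X \<omega>"
        using AE_C_abs[OF Q(2)] by (rule eventually_mono) (rule ind)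
    qed (auto simp: emeasure_space_1 indicator_def)
    then show ?thesis by simp
  qed
  have "eventually (\<lambda>n. emeasure Q2 (A n) = emeasure Q1 (A n)) sequentially"
    using eventually_gt_at_top[of 1] by eventually_elim (rule eq[OF _ A, symmetric])
  with lim[OF Q(3,4)] have "(\<lambda>n. emeasure Q1 (A n)) \<longlonglongrightarrow> emeasure Q2 X"
    by (rule Lim_transform_eventually)
  with lim[OF Q(1,2)] show "emeasure Q1 X = emeasure Q2 X"
    by (rule LIMSEQ_unique)
qed

section \<open>The two conditioned measures\<close>

lemma ui_martingale_cong_AE:
  assumes P: "prob_space P" "sets P = sets (filt Beyond)"
    and Y: "ui_martingale P Y"
    and eq: "AE \<omega> in P. \<forall>t. Y t \<omega> = Z t \<omega>"
    and Z: "\<And>t. t < \<infinity> \<Longrightarrow> Z t \<in> borel_measurable (filt (Time t))"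
  shows "ui_martingale P Z"
  unfolding ui_martingale_def
proof
  have mart: "nonneg_martingale P Y" and ui: "uniformly_integrable P Y"
    using Y by (auto simp: ui_martingale_def)
  have int: "(\<integral>\<^sup>+\<omega>\<in>A. Z t \<omega> \<partial>P) = (\<integral>\<^sup>+\<omega>\<in>A. Y t \<omega> \<partial>P)" for A t
    by (rule nn_integral_cong_AE) (use eq in \<open>auto elim: eventually_mono\<close>)
  show "nonneg_martingale P Z"
  proof (rule nonneg_martingaleI[OF P Z])
    fix t :: ennreal assume "t < \<infinity>"
    then show "(\<integral>\<^sup>+\<omega>. Z t \<omega> \<partial>P) < \<infinity>"
      using int[of t UNIV] mart by (simp add: nonneg_martingale_def)
  next
    fix s t A assume "s \<le> t" "t < (\<infinity>::ennreal)" "A \<in> sets (filt (Time s))"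
    then show "(\<integral>\<^sup>+\<omega>\<in>A. Z t \<omega> \<partial>P) = (\<integral>\<^sup>+\<omega>\<in>A. Z s \<omega> \<partial>P)"
      unfolding int by (rule nonneg_martingale_nn_integral[OF P mart])
  qed
  have "(\<integral>\<^sup>+\<omega>\<in>{\<omega>. c \<le> Z t \<omega>}. Z t \<omega> \<partial>P) = (\<integral>\<^sup>+\<omega>\<in>{\<omega>. c \<le> Y t \<omega>}. Y t \<omega> \<partial>P)" for c t
    by (rule nn_integral_cong_AE) (use eq in \<open>auto elim!: eventually_mono simp: indicator_def\<close>)
  then show "uniformly_integrable P Z"
    using ui unfolding uniformly_integrable_def by simp
qed

lemma foellmer_measure_hit:
  assumes P: "prob_space P" "sets P = sets (filt Beyond)" "coord_local_martingale P"
    and start: "AE \<omega> in P. \<omega> 0 = 1" and Q: "is_foellmer_measure P Q"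
    and a: "1 \<le> a" and A: "A \<in> sets (filt_at (hit (ennreal a)))"
  shows "emeasure Q A = (\<integral>\<^sup>+\<omega>\<in>A. stopped (hit (ennreal a)) \<infinity> \<omega> \<partial>P)"
proof -
  have "AE \<omega> in P. \<omega> 0 \<le> ennreal a"
    using start by (rule eventually_mono) (use a in simp)
  then show ?thesis
    using Q A ui_martingale_stopped_hit[OF P, of a] stopping_time_hit[of "ennreal a"]
    unfolding is_foellmer_measure_def by simp
qed

text \<open>Here the stopping time is constantly \<open>\<TT>\<close>, so that nothing is stopped and the density is
  \<open>X\<^sub>\<infinity>\<close>.\<close>

lemma foellmer_measure_ui_martingale:
  assumes Q: "is_foellmer_measure P Q" and ui: "ui_martingale P coord" and A: "A \<in> sets (filt Beyond)"
  shows "emeasure Q A = (\<integral>\<^sup>+\<omega>\<in>A. coord_infinity \<omega> \<partial>P)"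
proof -
  have eq: "stopped (\<lambda>_. Beyond) = coord"
    by (intro ext) (simp add: stopped_def)
  have "stopping_time filt (\<lambda>_. Beyond)" by (simp add: stopping_time_def)
  moreover have "A \<in> sets (filt_at (\<lambda>_. Beyond))" using A by (intro sets_filt_atI) auto
  ultimately have "emeasure Q A = (\<integral>\<^sup>+\<omega>\<in>A. stopped (\<lambda>_. Beyond) \<infinity> \<omega> \<partial>P)"
    using Q ui unfolding is_foellmer_measure_def eq[symmetric] by blast
  then show ?thesis by (simp add: eq)
qed

lemma survival_set:
  "{\<omega>\<in>C_abs. hit 0 \<omega> = Beyond} = {\<omega>\<in>C_abs. coord \<infinity> \<omega> > 0}"
  using hit_zero_eq_Beyond_iff by auto

lemma survival_set_measurable: "{\<omega>\<in>C_abs. hit 0 \<omega> = Beyond} \<in> sets (filt Beyond)"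
proof -
  have "{\<omega>\<in>space (filt Beyond). coord_infinity \<omega> > 0} \<in> sets (filt Beyond)"
    using coord_infinity_measurable by measurable
  then show ?thesis unfolding survival_set by simp
qed

text \<open>If \<open>b = 0\<close> then \<open>X\<close> stopped at \<open>T\<^sub>a\<close> ends in \<open>a\<close> or in \<open>0\<close>. So the density \<open>X\<^sub>T\<close> of the
  Foellmer measure is \<open>a\<close> times the indicator of hitting \<open>a\<close>, and total mass one forces the
  probability of that event to be \<open>1 / a\<close>.\<close>

lemma foellmer_measure_hit_conditioned:
  assumes P: "prob_space P" "sets P = sets (filt Beyond)" "coord_local_martingale P"
    and start: "AE \<omega> in P. \<omega> 0 = 1" and Q: "is_foellmer_measure P Q"
    and null: "AE \<omega> in P. hit 0 \<omega> \<noteq> Beyond"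
    and a: "1 < a" and A: "A \<in> sets (filt_at (hit (ennreal a)))"
  shows "emeasure Q A = emeasure (uniform_measure P {\<omega>\<in>C_abs. hit (ennreal a) \<omega> \<le> hit 0 \<omega>}) A"
proof -
  interpret P: prob_space P by fact
  interpret Q: prob_space Q using Q by (simp add: is_foellmer_measure_def)
  let ?B = "{\<omega>\<in>C_abs. hit (ennreal a) \<omega> \<le> hit 0 \<omega>}"
  have B_eq: "?B = {\<omega>\<in>C_abs. hit (ennreal a) \<omega> \<le> Time \<infinity>} \<union> {\<omega>\<in>C_abs. hit 0 \<omega> = Beyond}"
    using hit_le_hit_zero_iff[of _ "ennreal a"] a by auto
  have [measurable]: "?B \<in> sets P"
    unfolding B_eq P(2) using sets_filt_at_subset[OF hit_le_infinity_filt_at[of "ennreal a"]] survival_set_measurable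
    by (intro sets.Un) auto
  have dens: "AE \<omega> in P. stopped (hit (ennreal a)) \<infinity> \<omega> = ennreal a * indicator ?B \<omega>"
    using null AE_C_abs[OF P(2)]
  proof eventually_elim
    case (elim \<omega>)
    then have "coord_infinity \<omega> = 0" using hit_zero_eq_Beyond_iff by simp
    then show ?case using elim B_eq hit_le_hit_zero_iff[OF elim(2), of "ennreal a"] a
      by (auto simp: stopped_hit indicator_def)
  qed
  have Q_eq: "emeasure Q A' = ennreal a * emeasure P (?B \<inter> A')"
    if A': "A' \<in> sets (filt_at (hit (ennreal a)))" for A'
  proof -
    have [measurable]: "A' \<in> sets P" using sets_filt_at_subset[OF A'] P(2) by simp
    have "emeasure Q A' = (\<integral>\<^sup>+\<omega>\<in>A'. stopped (hit (ennreal a)) \<infinity> \<omega> \<partial>P)"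
      using a by (intro foellmer_measure_hit[OF P start Q _ A']) simp
    also have "\<dots> = (\<integral>\<^sup>+\<omega>. ennreal a * indicator (?B \<inter> A') \<omega> \<partial>P)"
      using dens by (intro nn_integral_cong_AE) (auto elim!: eventually_mono simp: indicator_def)
    also have "\<dots> = ennreal a * emeasure P (?B \<inter> A')" by (simp add: nn_integral_cmult)
    finally show ?thesis .
  qed
  have "sets Q = sets (filt Beyond)" using Q by (simp add: is_foellmer_measure_def)
  then have "emeasure Q C_abs = 1" using Q.emeasure_space_1 space_P by metis
  moreover have "C_abs \<in> sets (filt_at (hit (ennreal a)))"
    using sets.top[of "filt_at (hit (ennreal a))"] by simp
  moreover have "?B \<inter> C_abs = ?B" by auto
  ultimately have mass: "ennreal a * emeasure P ?B = 1" using Q_eq[of C_abs] by simp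
  have "emeasure P (?B \<inter> A) = emeasure Q A * emeasure P ?B"
  proof -
    have "emeasure Q A * emeasure P ?B = emeasure P (?B \<inter> A) * (ennreal a * emeasure P ?B)"
      unfolding Q_eq[OF A] by (simp only: ac_simps)
    then show ?thesis unfolding mass by simp
  qed
  moreover have "emeasure P ?B \<noteq> 0" using mass by auto
  ultimately have "emeasure P (?B \<inter> A) / emeasure P ?B = emeasure Q A"
    using P.emeasure_finite[of ?B] by (simp add: ennreal_mult_divide_eq)
  moreover have "A \<in> sets P" using sets_filt_at_subset[OF A] P(2) by simp
  ultimately show ?thesis by simp
qed

text \<open>A level \<open>a > 1 / b\<close> is almost surely never hit if \<open>Q = P(\<cdot> | T\<^sub>0 = \<TT>)\<close>: the Foellmer measure
  charges the event of hitting \<open>a\<close> with \<open>a\<close> times its probability, the conditional measure with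
  at most \<open>1 / b\<close> times. So \<open>X\<close> is the bounded process \<open>X\<close> stopped at \<open>T\<^sub>a\<close>.\<close>

lemma ui_martingale_if_foellmer_conditioned:
  fixes P Q :: "path measure"
  defines "B \<equiv> {\<omega>\<in>C_abs. hit 0 \<omega> = Beyond}"
  assumes P: "prob_space P" "sets P = sets (filt Beyond)" "coord_local_martingale P"
    and start: "AE \<omega> in P. \<omega> 0 = 1" and Q: "is_foellmer_measure P Q"
    and pos: "measure P B > 0" and eq: "Q = uniform_measure P B"
  shows "ui_martingale P coord"
proof -
  interpret prob_space P by fact
  \<comment> \<open>Any level above \<open>1 / b\<close> that is at least the initial value would do.\<close>
  define a where "a = 1 / measure P B + 1"
  have a: "1 \<le> a" "a > 1 / measure P B" using pos by (auto simp: a_def)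
  have [measurable]: "B \<in> sets P" unfolding B_def P(2) by (rule survival_set_measurable)
  define G where "G = {\<omega>\<in>C_abs. hit (ennreal a) \<omega> \<le> Time \<infinity>}"
  have G_at: "G \<in> sets (filt_at (hit (ennreal a)))" unfolding G_def by (rule hit_le_infinity_filt_at) simp
  then have GP [measurable]: "G \<in> sets P" unfolding P(2) by (rule sets_filt_at_subset)
  have "ennreal a * emeasure P G = (\<integral>\<^sup>+\<omega>\<in>G. stopped (hit (ennreal a)) \<infinity> \<omega> \<partial>P)"
  proof -
    have "(\<integral>\<^sup>+\<omega>\<in>G. stopped (hit (ennreal a)) \<infinity> \<omega> \<partial>P) = (\<integral>\<^sup>+\<omega>. ennreal a * indicator G \<omega> \<partial>P)"
      by (intro nn_integral_cong) (auto simp: G_def stopped_hit indicator_def)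
    then show ?thesis using nn_integral_cmult_indicator[OF GP] by (rule trans[symmetric])
  qed
  also have "\<dots> = emeasure Q G" using foellmer_measure_hit[OF P start Q a(1) G_at] ..
  also have "\<dots> = emeasure P (B \<inter> G) / emeasure P B"
    unfolding eq using \<open>B \<in> sets P\<close> GP by (rule emeasure_uniform_measure)
  also have "\<dots> \<le> emeasure P G / emeasure P B" by (intro divide_right_mono_ennreal emeasure_mono) auto
  finally have "a * measure P G \<le> measure P G / measure P B"
    using pos a(1) by (simp add: emeasure_eq_measure divide_ennreal ennreal_mult[symmetric])
  then have "(a - 1 / measure P B) * measure P G \<le> 0" by (simp add: algebra_simps)
  then have "measure P G = 0" using a(2) by (simp add: mult_le_0_iff measure_le_0_iff)
  then have "AE \<omega> in P. \<omega> \<notin> G" by (intro AE_not_in) (simp add: null_sets_def emeasure_eq_measure)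
  then have stopped_eq: "AE \<omega> in P. \<forall>t. stopped (hit (ennreal a)) t \<omega> = coord t \<omega>"
    using AE_C_abs[OF P(2)]
  proof eventually_elim
    case (elim \<omega>)
    then have "hit (ennreal a) \<omega> = Beyond" unfolding G_def by (cases "hit (ennreal a) \<omega>") auto
    then show ?case by (simp add: stopped_def)
  qed
  have ui: "ui_martingale P (stopped (hit (ennreal a)))"
    using start a(1) by (intro ui_martingale_stopped_hit[OF P]) (auto elim: eventually_mono)
  show ?thesis
    by (rule ui_martingale_cong_AE[OF P(1,2) ui stopped_eq]) (simp add: coord_measurable)
qed

text \<open>For a uniformly integrable \<open>X\<close> the Foellmer measure has density \<open>X\<^sub>\<infinity>\<close>, and densities are
  almost surely unique.\<close>

lemma foellmer_eq_conditioned_iff: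
  fixes P Q :: "path measure"
  defines "B \<equiv> {\<omega>\<in>C_abs. hit 0 \<omega> = Beyond}"
  assumes P: "prob_space P" "sets P = sets (filt Beyond)"
    and Q: "is_foellmer_measure P Q" and ui: "ui_martingale P coord" and pos: "measure P B > 0"
  shows "Q = uniform_measure P B \<longleftrightarrow> (AE \<omega> in P. coord_infinity \<omega> \<in> {0, ennreal (1 / measure P B)})"
proof -
  interpret prob_space P by fact
  have [measurable]: "B \<in> sets P" unfolding B_def P(2) by (rule survival_set_measurable)
  have [measurable]: "coord_infinity \<in> borel_measurable P"
    using coord_infinity_measurable by (rule filt_measurableI[OF P(2)])
  have "sets Q = sets P" using Q P(2) by (simp add: is_foellmer_measure_def)
  then have Q_eq: "Q = density P coord_infinity"
    using foellmer_measure_ui_martingale[OF Q ui] P(2)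
    by (intro measure_eqI) (simp_all add: emeasure_density)
  have dens_eq: "indicator B \<omega> / emeasure P B = ennreal (1 / measure P B) * indicator B \<omega>" for \<omega>
    using pos by (simp add: emeasure_eq_measure divide_ennreal_def inverse_ennreal inverse_eq_divide mult.commute)
  have "Q = uniform_measure P B \<longleftrightarrow> (AE \<omega> in P. coord_infinity \<omega> = ennreal (1 / measure P B) * indicator B \<omega>)"
    unfolding Q_eq uniform_measure_def dens_eq by (intro density_unique_iff) auto
  also have "\<dots> \<longleftrightarrow> (AE \<omega> in P. coord_infinity \<omega> \<in> {0, ennreal (1 / measure P B)})"
  proof (rule eventually_subst)
    show "AE \<omega> in P. coord_infinity \<omega> = ennreal (1 / measure P B) * indicator B \<omega> \<longleftrightarrow>
        coord_infinity \<omega> \<in> {0, ennreal (1 / measure P B)}"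
      using AE_C_abs[OF P(2)]
    proof eventually_elim
      case (elim \<omega>)
      have "\<omega> \<in> B \<longleftrightarrow> coord_infinity \<omega> \<noteq> 0"
        using elim hit_zero_eq_Beyond_iff[OF elim] by (simp add: B_def zero_less_iff_neq_zero)
      then show ?case by (auto simp: indicator_def)
    qed
  qed
  finally show ?thesis .
qed

theorem theorem2p2:
  fixes P Q :: "path measure" and b :: real
  assumes "prob_space P" and "sets P = sets (filt Beyond)"
    and "coord_local_martingale P"
    and "measure P {\<omega>\<in>C_abs. coord 0 \<omega> = 1} = 1"
    and "b = measure P {\<omega>\<in>C_abs. hit 0 \<omega> = Beyond}"
    and "is_foellmer_measure P Q"
  shows "b = measure P {\<omega>\<in>C_abs. coord \<infinity> \<omega> > 0} \<and>
    (b = 0 \<longrightarrow> (\<forall>Qt. is_upward_conditioned_measure P Qt \<longleftrightarrow> Q = Qt)) \<and>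
    (b > 0 \<longrightarrow>
      (Q = uniform_measure P {\<omega>\<in>C_abs. hit 0 \<omega> = Beyond} \<longleftrightarrow>
       ui_martingale P coord \<and> measure P {\<omega>\<in>C_abs. coord \<infinity> \<omega> \<in> {0, ennreal (1 / b)}} = 1))"
proof (intro conjI impI allI)
  note P = assms(1-3) and Q = assms(6)
  interpret prob_space P by fact
  have space: "space P = C_abs" by (rule space_P[OF P(2)])
  have Q': "prob_space Q" "sets Q = sets (filt Beyond)" using Q by (auto simp: is_foellmer_measure_def)
  let ?B = "{\<omega>\<in>C_abs. hit 0 \<omega> = Beyond}"
  have B: "?B \<in> sets P" unfolding P(2) by (rule survival_set_measurable)
  have start: "AE \<omega> in P. \<omega> 0 = 1"
  proof -
    have "coord 0 \<omega> = \<omega> 0" for \<omega> by (simp add: coord_def)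
    moreover have "coord 0 \<in> borel_measurable P"
      using coord_measurable_Beyond by (rule filt_measurableI[OF P(2)])
    then have "{\<omega>\<in>space P. coord 0 \<omega> = 1} \<in> sets P" by measurable
    ultimately show ?thesis using assms(4) prob_Collect_eq_1[of "\<lambda>\<omega>. coord 0 \<omega> = 1"] by (simp add: space)
  qed
  show "b = measure P {\<omega>\<in>C_abs. coord \<infinity> \<omega> > 0}" using assms(5) by (simp only: survival_set)
  {
    fix Qt assume "b = 0"
    then have "?B \<in> null_sets P" using B assms(5) by (simp add: null_sets_def emeasure_eq_measure)
    then have null: "AE \<omega> in P. hit 0 \<omega> \<noteq> Beyond"
      using AE_not_in[of ?B P] AE_C_abs[OF P(2)] by (auto elim: eventually_elim2)
    note conditioned = foellmer_measure_hit_conditioned[OF P start Q null]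
    show "is_upward_conditioned_measure P Qt \<longleftrightarrow> Q = Qt"
    proof
      assume Qt: "is_upward_conditioned_measure P Qt"
      show "Q = Qt"
      proof (rule measure_eqI_before_hits[OF Q'])
        show "prob_space Qt" "sets Qt = sets (filt Beyond)"
          using Qt by (auto simp: is_upward_conditioned_measure_def)
        fix n :: nat and A assume n: "1 < n" and A: "A \<in> sets (filt_at (hit (of_nat n)))"
        have "A \<in> sets (filt_at (hit (ennreal (real n))))" "1 < real n"
          using n A by (simp_all add: ennreal_of_nat_eq_real_of_nat)
        then show "emeasure Q A = emeasure Qt A"
          using Qt conditioned unfolding is_upward_conditioned_measure_def by metis
      qed
    next
      assume "Q = Qt"
      then show "is_upward_conditioned_measure P Qt"
        using Q' conditioned by (auto simp: is_upward_conditioned_measure_def)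
    qed
  }
  assume "b > 0"
  then have pos: "measure P ?B > 0" using assms(5) by simp
  have "{\<omega>\<in>space P. coord_infinity \<omega> \<in> {0, ennreal (1 / b)}} \<in> sets P"
    using filt_measurableI[OF P(2) coord_infinity_measurable] by measurable
  then have "measure P {\<omega>\<in>C_abs. coord \<infinity> \<omega> \<in> {0, ennreal (1 / b)}} = 1 \<longleftrightarrow>
      (AE \<omega> in P. coord_infinity \<omega> \<in> {0, ennreal (1 / b)})"
    using prob_Collect_eq_1[of "\<lambda>\<omega>. coord_infinity \<omega> \<in> {0, ennreal (1 / b)}"] by (simp add: space)
  then show "Q = uniform_measure P ?B \<longleftrightarrow>
       ui_martingale P coord \<and> measure P {\<omega>\<in>C_abs. coord \<infinity> \<omega> \<in> {0, ennreal (1 / b)}} = 1"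
    using ui_martingale_if_foellmer_conditioned[OF P start Q pos]
      foellmer_eq_conditioned_iff[OF P(1,2) Q _ pos] unfolding assms(5) by blast
qed

end
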